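(* Let $X\subset\mathbb P^2$ be any zeroscheme, with saturated ideal $I_X\subset R=k[x_1,x_2,x_3]$. Let $F\in R_d$ be a generally chosen polynomial of degree $d$. Then the Artinian ideal $I:=I_X+(F)\subset R$ has the Weak Lefschetz property, i.e. $R/I$ has the Weak Lefschetz property.
   Context: $k$ is an infinite field and $R$ is standard graded, with $R_d$ its space of forms of degree $d$. A zeroscheme is a zero-dimensional closed subscheme. "Generally chosen" $F\in R_d$ means: the statement holds for all $F$ in a nonempty Zariski open subset of $R_d$ (depending on $X$). A standard graded Artinian $k$-algebra $A=\bigoplus A_i$ has the Weak Lefschetz property if for a general linear form $L$ the multiplication map $\times L:A_i\to A_{i+1}$ has maximal rank (is injective or surjective) for every $i$. *)

theory Defs
  imports
    "HOL-Algebra.QuotRing"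
    "HOL-Library.Poly_Mapping"
    "HOL-Library.Numeral_Type"
    "HOL-Library.Extended_Nat"
begin

text \<open>
  The polynomial ring over \<open>'k\<close> in the variables \<open>'v\<close> is the monoid algebra provided by
  \<open>Poly_Mapping\<close>; \<open>poly_ring\<close> wraps it as a record, so that the ideals and quotients of
  HOL-Algebra apply to it.
\<close>

type_synonym ('v, 'k) mpoly = "('v \<Rightarrow>\<^sub>0 nat) \<Rightarrow>\<^sub>0 'k"

definition poly_ring :: "('v, 'k::comm_ring_1) mpoly ring" where
  "poly_ring = \<lparr>carrier = UNIV, mult = (*), one = 1, zero = 0, add = (+)\<rparr>"

lemma cring_poly_ring: "cring (poly_ring :: ('v, 'k::comm_ring_1) mpoly ring)"
proof (rule cringI)
  show "abelian_group (poly_ring :: ('v, 'k) mpoly ring)"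
    by (rule abelian_groupI)
      (auto simp: poly_ring_def add.assoc add.commute intro: exI[of _ "- x" for x])
  show "comm_monoid (poly_ring :: ('v, 'k) mpoly ring)"
    by (rule comm_monoidI) (auto simp: poly_ring_def mult.assoc mult.commute)
qed (simp add: poly_ring_def distrib_right)

definition monom_deg :: "('v \<Rightarrow>\<^sub>0 nat) \<Rightarrow> nat" where
  "monom_deg m = (\<Sum>v\<in>Poly_Mapping.keys m. Poly_Mapping.lookup m v)"

definition forms :: "nat \<Rightarrow> ('v, 'k::comm_ring_1) mpoly set" where
  "forms d = {f. \<forall>m\<in>Poly_Mapping.keys f. monom_deg m = d}"

definition hom_component :: "nat \<Rightarrow> ('v, 'k::comm_ring_1) mpoly \<Rightarrow> ('v, 'k) mpoly" where
  "hom_component d f =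
    (\<Sum>m\<in>{m\<in>Poly_Mapping.keys f. monom_deg m = d}.
      Poly_Mapping.single m (Poly_Mapping.lookup f m))"

definition homogeneous_ideal :: "('v, 'k::comm_ring_1) mpoly set \<Rightarrow> bool" where
  "homogeneous_ideal I \<longleftrightarrow> ideal I poly_ring \<and> (\<forall>f\<in>I. \<forall>d. hom_component d f \<in> I)"

definition irrelevant_ideal :: "('v, 'k::comm_ring_1) mpoly set" where
  "irrelevant_ideal = {f. Poly_Mapping.lookup f 0 = 0}"

text \<open>
  The \<open>n\<close>-th power of the irrelevant ideal is generated by the forms of degree \<open>n\<close>, so
  this is the ideal of all \<open>f\<close> multiplied into \<open>I\<close> by some power of the irrelevant ideal.
\<close>

definition saturation :: "('v, 'k::comm_ring_1) mpoly set \<Rightarrow> ('v, 'k) mpoly set" where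
  "saturation I = {f. \<exists>n. \<forall>g\<in>forms n. g * f \<in> I}"

text \<open>
  The points of the closed subscheme \<open>Proj (R/I)\<close> of projective space, and its dimension: the
  irreducible closed subsets are the closures of the points, so chains of them correspond
  to chains of points ordered by inclusion. Note that the supremum in \<^typ>\<open>enat\<close> is also
  \<open>0\<close> when there are no points.
\<close>

definition proj_points :: "('v, 'k::comm_ring_1) mpoly set \<Rightarrow> ('v, 'k) mpoly set set" where
  "proj_points I =
    {P. primeideal P poly_ring \<and> homogeneous_ideal P \<and> I \<subseteq> P \<and> \<not> irrelevant_ideal \<subseteq> P}"

definition proj_dim :: "('v, 'k::comm_ring_1) mpoly set \<Rightarrow> enat" where
  "proj_dim I =
    Sup {enat n | n. \<exists>P. (\<forall>i\<le>n. P i \<in> proj_points I) \<and> (\<forall>i<n. P i \<subset> P (Suc i))}"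

text \<open>
  Closed subschemes of projective space correspond bijectively to saturated homogeneous
  ideals; the empty subscheme is not zero-dimensional.
\<close>

definition zeroscheme_ideal :: "('v, 'k::comm_ring_1) mpoly set \<Rightarrow> bool" where
  "zeroscheme_ideal I \<longleftrightarrow>
    homogeneous_ideal I \<and> saturation I = I \<and> proj_points I \<noteq> {} \<and> proj_dim I = 0"

definition eval_mpoly :: "('v, 'k::comm_ring_1) mpoly \<Rightarrow> ('v \<Rightarrow> 'k) \<Rightarrow> 'k" where
  "eval_mpoly p a =
    (\<Sum>m\<in>Poly_Mapping.keys p. Poly_Mapping.lookup p m *
      (\<Prod>v\<in>Poly_Mapping.keys m. a v ^ Poly_Mapping.lookup m v))"

text \<open>
  The coordinates of a form are its coefficients, so the polynomial functions on the space of
  forms of degree \<open>d\<close> are polynomials whose variables are indexed by monomials (the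
  coordinates at monomials of other degrees vanish there).
\<close>

definition zariski_open_forms :: "nat \<Rightarrow> ('v, 'k::comm_ring_1) mpoly set \<Rightarrow> bool" where
  "zariski_open_forms d U \<longleftrightarrow>
    (\<exists>S :: ('v \<Rightarrow>\<^sub>0 nat, 'k) mpoly set.
      U = {F\<in>forms d. \<exists>p\<in>S. eval_mpoly p (Poly_Mapping.lookup F) \<noteq> 0})"

definition for_general_form ::
    "nat \<Rightarrow> (('v, 'k::comm_ring_1) mpoly \<Rightarrow> bool) \<Rightarrow> bool" where
  "for_general_form d P \<longleftrightarrow> (\<exists>U. zariski_open_forms d U \<and> U \<noteq> {} \<and> (\<forall>F\<in>U. P F))"

definition artinian_ring :: "('a, 'b) ring_scheme \<Rightarrow> bool" where
  "artinian_ring A \<longleftrightarrow> cring A \<and>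
    (\<forall>J :: nat \<Rightarrow> 'a set. (\<forall>n. ideal (J n) A \<and> J (Suc n) \<subseteq> J n) \<longrightarrow>
      (\<exists>n. \<forall>m\<ge>n. J m = J n))"

definition graded_piece ::
    "('v, 'k::comm_ring_1) mpoly set \<Rightarrow> nat \<Rightarrow> ('v, 'k) mpoly set set" where
  "graded_piece I i = (\<lambda>f. I +>\<^bsub>poly_ring\<^esub> f) ` forms i"

definition mult_by ::
    "('v, 'k::comm_ring_1) mpoly set \<Rightarrow> ('v, 'k) mpoly \<Rightarrow> ('v, 'k) mpoly set \<Rightarrow> ('v, 'k) mpoly set"
  where "mult_by I L a = (I +>\<^bsub>poly_ring\<^esub> L) \<otimes>\<^bsub>poly_ring Quot I\<^esub> a"

definition weak_lefschetz :: "('v, 'k::comm_ring_1) mpoly set \<Rightarrow> bool" where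
  "weak_lefschetz I \<longleftrightarrow>
    homogeneous_ideal I \<and> artinian_ring (poly_ring Quot I) \<and>
    for_general_form 1 (\<lambda>L. \<forall>i.
      inj_on (mult_by I L) (graded_piece I i) \<or>
      mult_by I L ` graded_piece I i = graded_piece I (Suc i))"

end

theory Submission imports Defs "HOL-Computational_Algebra.Polynomial" begin

text \<open>
  Write \<open>I\<close> for the ideal of \<open>X\<close> and \<open>R\<close> for the polynomial ring. Three ideas give the theorem.

  A nonzerodivisor. Because \<open>X\<close> has dimension zero, some linear form \<open>L\<close> misses all points of \<open>X\<close>,
  so that \<open>R/(I + (L))\<close> has finite length (\<open>ex_moment_form_finite_colength\<close>); because \<open>I\<close> is
  saturated, \<open>L\<close> is then a nonzerodivisor modulo \<open>I\<close> (\<open>nonzerodivisor_if_finite_colength\<close>).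

  Exchange of \<open>L\<close> and \<open>F\<close>. The cokernels of \<open>L\<close> on \<open>R/(I + (F))\<close> and of \<open>F\<close> on \<open>R/(I + (L))\<close> are
  the same, and since \<open>L\<close> is a nonzerodivisor modulo \<open>I\<close>, injectivity of the second map in a degree
  implies that of the first in the corresponding degree. So \<open>L\<close> has maximal rank on \<open>R/(I + (F))\<close> in
  all degrees if \<open>F\<close> has maximal rank on \<open>R/(I + (L))\<close> in all degrees (\<open>max_rank_exchange\<close>); and
  \<open>R/(I + (L))\<close> is a quotient of a polynomial ring in two variables, the coordinate ring of the
  line \<open>L = 0\<close>.

  Maximal rank on a line, in every characteristic. Let \<open>F\<close> be a product of \<open>d\<close> linear forms on the
  line with different zeros. Its multiples of degree \<open>n + d\<close> are the forms that vanish at these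
  \<open>d\<close> points, and the image \<open>V\<close> of \<open>I\<close> in degree \<open>n + d\<close> is a linear space of forms. General points
  impose independent conditions on \<open>V\<close>, for as long as any member is left
  (\<open>ex_points_in_general_position\<close>). Hence either no nonzero member of \<open>V\<close> vanishes at all the
  points, and then \<open>F\<close> is injective, or the values of members of \<open>V\<close> at the points can be
  prescribed, and then \<open>V\<close> and the multiples of \<open>F\<close> span all forms of degree \<open>n + d\<close>, which is
  surjectivity (\<open>ex_form_max_rank\<close>).

  It remains to pass from one \<open>F\<close> to a general one, and from one \<open>L\<close> to a general one. Maximal
  rank in a fixed degree is an open condition (\<open>zariski_near_forms_subset_adjoin\<close>,
  \<open>zariski_near_mult_injective\<close>), and finite colength leaves only finitely many degrees to
  consider (\<open>zariski_near_max_rank\<close>). That \<open>R/(I + (F))\<close> has finite length for a general \<open>F\<close> of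
  degree \<open>d\<close> follows by the same openness from the example \<open>F = L ^ d\<close>.
\<close>

section \<open>Forms and homogeneous ideals\<close>

lemma poly_ring_simps [simp]:
  "carrier poly_ring = UNIV" "monoid.mult poly_ring = (*)" "\<one>\<^bsub>poly_ring\<^esub> = 1"
  "\<zero>\<^bsub>poly_ring\<^esub> = 0" "ring.add poly_ring = (+)"
  by (simp_all add: poly_ring_def)

lemma ring_poly_ring: "ring (poly_ring :: ('v, 'k::comm_ring_1) mpoly ring)"
  using cring_poly_ring by (rule cring.axioms(1))

lemma ideal_poly_ringI:
  fixes I :: "('v, 'k::comm_ring_1) mpoly set"
  assumes "0 \<in> I" "\<And>a b. a \<in> I \<Longrightarrow> b \<in> I \<Longrightarrow> a + b \<in> I" "\<And>a r. a \<in> I \<Longrightarrow> r * a \<in> I"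
  shows "ideal I poly_ring"
proof (rule idealI[OF ring_poly_ring])
  have inv: "inv\<^bsub>add_monoid poly_ring\<^esub> a = - a" for a :: "('v, 'k) mpoly"
    using abelian_group.minus_equality[OF ring.is_abelian_group[OF ring_poly_ring], of "- a" a]
    by (simp add: a_inv_def)
  show "subgroup I (add_monoid poly_ring)"
    using assms(1,2) assms(3)[of _ "- 1"] by (auto intro!: subgroup.intro simp: inv[simplified])
qed (use assms(3) in \<open>auto simp: mult.commute\<close>)

lemma
  fixes I :: "('v, 'k::comm_ring_1) mpoly set"
  assumes "ideal I poly_ring"
  shows ideal_zero: "0 \<in> I"
    and ideal_add: "a \<in> I \<Longrightarrow> b \<in> I \<Longrightarrow> a + b \<in> I"
    and ideal_mult: "a \<in> I \<Longrightarrow> r * a \<in> I"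
    and ideal_mult_right: "a \<in> I \<Longrightarrow> a * r \<in> I"
    and ideal_minus: "a \<in> I \<Longrightarrow> - a \<in> I"
    and ideal_diff: "a \<in> I \<Longrightarrow> b \<in> I \<Longrightarrow> a - b \<in> I"
proof -
  interpret ideal I poly_ring by fact
  show z: "0 \<in> I" using additive_subgroup.zero_closed[OF is_additive_subgroup] by simp
  show a: "a + b \<in> I" if "a \<in> I" "b \<in> I" for a b using additive_subgroup.a_closed[OF is_additive_subgroup that] by simp
  show m: "r * a \<in> I" if "a \<in> I" for r a using I_l_closed[OF that, of r] by simp
  show "a * r \<in> I" if "a \<in> I" for r a using m[OF that, of r] by (simp add: mult.commute)
  show n: "- a \<in> I" if "a \<in> I" for a using m[OF that, of "- 1"] by simp
  show "a - b \<in> I" if "a \<in> I" "b \<in> I" for a b using a[OF that(1) n[OF that(2)]] by simp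
qed

lemma ideal_sum:
  fixes I :: "('v, 'k::comm_ring_1) mpoly set"
  assumes "ideal I poly_ring" "\<And>i. i \<in> A \<Longrightarrow> f i \<in> I"
  shows "sum f A \<in> I"
  using assms(2) by (induction A rule: infinite_finite_induct)
    (auto simp: ideal_zero[OF assms(1)] ideal_add[OF assms(1)])

definition adjoin :: "('v, 'k::comm_ring_1) mpoly set \<Rightarrow> ('v, 'k) mpoly \<Rightarrow> ('v, 'k) mpoly set" where
  "adjoin I f = {a + r * f | a r. a \<in> I}"

lemma set_add_PIdl_eq_adjoin: "I <+>\<^bsub>poly_ring\<^esub> PIdl\<^bsub>poly_ring\<^esub> f = adjoin I f"
  by (auto simp: set_add_def' cgenideal_def adjoin_def)

lemma adjoinI: "a \<in> I \<Longrightarrow> g = a + r * f \<Longrightarrow> g \<in> adjoin I f"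
  by (auto simp: adjoin_def)

lemma adjoinE:
  assumes "g \<in> adjoin I f" obtains a r where "a \<in> I" "g = a + r * f"
  using assms by (auto simp: adjoin_def)

lemma ideal_adjoin:
  fixes I :: "('v, 'k::comm_ring_1) mpoly set"
  assumes I: "ideal I poly_ring"
  shows "ideal (adjoin I f) poly_ring"
proof (rule ideal_poly_ringI)
  show "0 \<in> adjoin I f" using ideal_zero[OF I] by (rule adjoinI[where r = 0]) simp
next
  fix g h assume "g \<in> adjoin I f" "h \<in> adjoin I f"
  then obtain a r b s where *: "a \<in> I" "g = a + r * f" "b \<in> I" "h = b + s * f"
    by (auto elim!: adjoinE)
  show "g + h \<in> adjoin I f"
    by (rule adjoinI[of "a + b" _ _ "r + s"])
      (use * in \<open>auto simp: ideal_add[OF I] algebra_simps\<close>)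
next
  fix g u assume "g \<in> adjoin I f"
  then obtain a r where *: "a \<in> I" "g = a + r * f" by (auto elim!: adjoinE)
  show "u * g \<in> adjoin I f"
    by (rule adjoinI[of "u * a" _ _ "u * r"])
      (use * in \<open>auto simp: ideal_mult[OF I] distrib_left mult.assoc\<close>)
qed

lemma subset_adjoin: "I \<subseteq> adjoin I f"
  by (auto intro!: adjoinI[where r = 0])

lemma mem_adjoin:
  assumes "ideal I poly_ring" shows "f \<in> adjoin I f"
  by (rule adjoinI[of 0 _ _ 1]) (simp_all add: ideal_zero[OF assms])

lemma adjoin_subset:
  assumes "ideal J poly_ring" "I \<subseteq> J" "f \<in> J" shows "adjoin I f \<subseteq> J"
  using assms(2,3) by (auto elim!: adjoinE intro!: ideal_add[OF assms(1)] ideal_mult[OF assms(1)])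

lemma adjoin_mono: "I \<subseteq> J \<Longrightarrow> adjoin I f \<subseteq> adjoin J f"
  by (auto simp: adjoin_def)

lemma monom_deg_superset:
  assumes "finite A" "Poly_Mapping.keys m \<subseteq> A"
  shows "monom_deg m = (\<Sum>v\<in>A. Poly_Mapping.lookup m v)"
  unfolding monom_deg_def using assms
  by (intro sum.mono_neutral_left) (auto simp: in_keys_iff)

lemma monom_deg_add: "monom_deg (m + n) = monom_deg m + monom_deg n"
proof -
  let ?A = "Poly_Mapping.keys m \<union> Poly_Mapping.keys n"
  have "monom_deg (m + n) = (\<Sum>v\<in>?A. Poly_Mapping.lookup (m + n) v)"
    by (rule monom_deg_superset) (use Poly_Mapping.keys_add[of m n] in auto)
  then show ?thesis
    by (simp add: lookup_add sum.distrib monom_deg_superset[of ?A m] monom_deg_superset[of ?A n])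
qed

lemma monom_deg_0 [simp]: "monom_deg 0 = 0"
  by (simp add: monom_deg_def)

lemma monom_deg_single [simp]: "monom_deg (Poly_Mapping.single v n) = n"
  by (simp add: monom_deg_def)

lemma monom_deg_eq_0_iff: "monom_deg m = 0 \<longleftrightarrow> m = 0"
  by (auto simp: monom_deg_def in_keys_iff intro!: poly_mapping_eqI)

lemma monom_deg_Suc_split:
  assumes "monom_deg m = Suc n"
  obtains v m' where "m = Poly_Mapping.single v (Suc 0) + m'" "monom_deg m' = n"
proof -
  from assms have "m \<noteq> 0" by auto
  then obtain v where v: "Poly_Mapping.lookup m v \<noteq> 0"
    by (metis lookup_zero poly_mapping_eqI)
  define m' where "m' = m - Poly_Mapping.single v (Suc 0)"
  have m: "m = Poly_Mapping.single v (Suc 0) + m'"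
    using v by (intro poly_mapping_eqI) (auto simp: m'_def lookup_add lookup_minus lookup_single when_def)
  with assms have "monom_deg m' = n" by (simp add: monom_deg_add)
  with m show ?thesis by (rule that)
qed

lemma monom_deg_split:
  assumes "monom_deg m = a + b"
  obtains m1 m2 where "m = m1 + m2" "monom_deg m1 = a" "monom_deg m2 = b"
proof -
  have "\<exists>m1 m2. m = m1 + m2 \<and> monom_deg m1 = a \<and> monom_deg m2 = b"
    using assms
  proof (induction a arbitrary: m)
    case 0
    then show ?case by (intro exI[of _ 0] exI[of _ m]) simp
  next
    case (Suc a)
    then obtain v m' where m': "m = Poly_Mapping.single v (Suc 0) + m'" "monom_deg m' = a + b"
      by (auto elim: monom_deg_Suc_split)
    from Suc.IH[OF m'(2)] obtain m1 m2 where "m' = m1 + m2" "monom_deg m1 = a" "monom_deg m2 = b"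
      by blast
    with m' show ?case
      by (intro exI[of _ "Poly_Mapping.single v (Suc 0) + m1"] exI[of _ m2]) (auto simp: monom_deg_add add.assoc)
  qed
  with that show ?thesis by blast
qed

definition monoms_of_deg :: "nat \<Rightarrow> ('v \<Rightarrow>\<^sub>0 nat) set" where
  "monoms_of_deg n = {m. monom_deg m = n}"

lemma finite_monoms_of_deg: "finite (monoms_of_deg n :: ('v::finite \<Rightarrow>\<^sub>0 nat) set)"
proof (rule finite_imageD)
  have "Poly_Mapping.lookup m v \<le> n" if "m \<in> monoms_of_deg n" for m :: "'v \<Rightarrow>\<^sub>0 nat" and v
    using that member_le_sum[of v UNIV "Poly_Mapping.lookup m"]
    by (simp add: monoms_of_deg_def monom_deg_superset[of UNIV])
  then have "Poly_Mapping.lookup ` (monoms_of_deg n :: ('v \<Rightarrow>\<^sub>0 nat) set) \<subseteq> Pi\<^sub>E UNIV (\<lambda>_. {..n})"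
    by auto
  then show "finite (Poly_Mapping.lookup ` (monoms_of_deg n :: ('v \<Rightarrow>\<^sub>0 nat) set))"
    by (rule finite_subset) (intro finite_PiE; simp)
  show "inj_on Poly_Mapping.lookup (monoms_of_deg n :: ('v \<Rightarrow>\<^sub>0 nat) set)"
    by (simp add: inj_on_def)
qed

abbreviation Const :: "'k \<Rightarrow> ('v, 'k::comm_ring_1) mpoly" where
  "Const c \<equiv> Poly_Mapping.single 0 c"

abbreviation Mon :: "('v \<Rightarrow>\<^sub>0 nat) \<Rightarrow> ('v, 'k::comm_ring_1) mpoly" where
  "Mon m \<equiv> Poly_Mapping.single m 1"

abbreviation Var :: "'v \<Rightarrow> ('v, 'k::comm_ring_1) mpoly" where
  "Var v \<equiv> Mon (Poly_Mapping.single v (Suc 0))"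

lemma single_eq_Const_mult_Mon: "Poly_Mapping.single m c = Const c * Mon m"
  by (simp add: mult_single)

lemma lookup_Const_mult [simp]:
  fixes f :: "('v, 'k::comm_ring_1) mpoly"
  shows "Poly_Mapping.lookup (Const c * f) m = c * Poly_Mapping.lookup f m"
proof -
  have "(\<Sum>q. Poly_Mapping.lookup f q when m = q) = Poly_Mapping.lookup f m"
    by (subst Sum_any.expand_superset[of "{m}"]) (auto simp: when_def)
  moreover have "{l. (c when 0 = l) * (\<Sum>q. Poly_Mapping.lookup f q when m = l + q) \<noteq> 0} \<subseteq> {0}"
    by (auto simp: when_def split: if_splits)
  ultimately show ?thesis
    by (simp add: lookup_mult lookup_single Sum_any.expand_superset[of "{0}"])
qed

lemma poly_mapping_sum_superset:
  fixes f :: "('v, 'k::comm_ring_1) mpoly"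
  assumes "finite A" "Poly_Mapping.keys f \<subseteq> A"
  shows "f = (\<Sum>m\<in>A. Poly_Mapping.single m (Poly_Mapping.lookup f m))"
proof (rule poly_mapping_eqI)
  fix k
  have "Poly_Mapping.lookup (\<Sum>m\<in>A. Poly_Mapping.single m (Poly_Mapping.lookup f m)) k
      = (\<Sum>m\<in>A. if m = k then Poly_Mapping.lookup f k else 0)"
    by (simp add: lookup_sum lookup_single when_def cong: if_cong)
  then show "Poly_Mapping.lookup f k
      = Poly_Mapping.lookup (\<Sum>m\<in>A. Poly_Mapping.single m (Poly_Mapping.lookup f m)) k"
    using assms by (auto simp: in_keys_iff subset_iff)
qed

lemma mpoly_induct [case_names zero add single]:
  fixes f :: "('v, 'k::comm_ring_1) mpoly"
  assumes "P 0" "\<And>f g. P f \<Longrightarrow> P g \<Longrightarrow> P (f + g)" "\<And>m c. m \<in> Poly_Mapping.keys f \<Longrightarrow> P (Poly_Mapping.single m c)"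
  shows "P f"
proof -
  have "P (\<Sum>m\<in>A. Poly_Mapping.single m (Poly_Mapping.lookup f m))"
    if "finite A" "A \<subseteq> Poly_Mapping.keys f" for A
    using that by (induction A) (auto intro: assms)
  from this[of "Poly_Mapping.keys f"] show ?thesis
    by (simp add: poly_mapping_sum_superset[of "Poly_Mapping.keys f" f, symmetric])
qed

lemma forms_iff_lookup:
  "f \<in> forms d \<longleftrightarrow> (\<forall>m. monom_deg m \<noteq> d \<longrightarrow> Poly_Mapping.lookup f m = 0)"
  by (auto simp: forms_def in_keys_iff)

lemma forms_zero [simp]: "0 \<in> forms d"
  and forms_add: "f \<in> forms d \<Longrightarrow> g \<in> forms d \<Longrightarrow> f + g \<in> forms d"
  and forms_diff: "f \<in> forms d \<Longrightarrow> g \<in> forms d \<Longrightarrow> f - g \<in> forms d"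
  and forms_Const_mult: "f \<in> forms d \<Longrightarrow> Const c * f \<in> forms d"
  by (auto simp: forms_iff_lookup lookup_add lookup_minus)

lemma forms_sum: "(\<And>i. i \<in> A \<Longrightarrow> f i \<in> forms d) \<Longrightarrow> sum f A \<in> forms d"
  by (simp add: forms_iff_lookup lookup_sum)

lemma single_in_forms: "monom_deg m = d \<Longrightarrow> Poly_Mapping.single m c \<in> forms d"
  by (auto simp: forms_iff_lookup lookup_single when_def)

lemma forms_eq_sum:
  fixes f :: "('v::finite, 'k::comm_ring_1) mpoly"
  assumes "f \<in> forms d"
  shows "f = (\<Sum>m\<in>monoms_of_deg d. Const (Poly_Mapping.lookup f m) * Mon m)"
  unfolding single_eq_Const_mult_Mon[symmetric]
  by (rule poly_mapping_sum_superset[OF finite_monoms_of_deg])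
     (use assms in \<open>auto simp: forms_def monoms_of_deg_def\<close>)

lemma forms_mult:
  fixes f g :: "('v, 'k::comm_ring_1) mpoly"
  assumes "f \<in> forms a" "g \<in> forms b"
  shows "f * g \<in> forms (a + b)"
proof -
  have "{x + y | x y. x \<in> Poly_Mapping.keys f \<and> y \<in> Poly_Mapping.keys g} \<subseteq> {m. monom_deg m = a + b}"
    using assms by (auto simp: forms_def monom_deg_add)
  then show ?thesis
    using keys_mult[of f g] unfolding forms_def by blast
qed

lemma forms_induct [consumes 1, case_names zero add single]:
  fixes f :: "('v, 'k::comm_ring_1) mpoly"
  assumes "f \<in> forms d" "P 0" "\<And>f g. P f \<Longrightarrow> P g \<Longrightarrow> P (f + g)"
    "\<And>m c. monom_deg m = d \<Longrightarrow> P (Poly_Mapping.single m c)"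
  shows "P f"
  using assms(2,3) by (rule mpoly_induct) (use assms(1,4) in \<open>auto simp: forms_def\<close>)

lemma one_in_forms_0 [simp]: "1 \<in> forms 0"
  unfolding single_one[symmetric] by (rule single_in_forms) simp

lemma forms_power:
  fixes f :: "('v, 'k::comm_ring_1) mpoly"
  assumes "f \<in> forms a" shows "f ^ n \<in> forms (n * a)"
  by (induction n) (auto intro: forms_mult[OF assms] simp del: mult_Suc simp: mult_Suc)

text \<open>
  A monomial of degree \<open>a + b\<close> is a product of monomials of degrees \<open>a\<close> and \<open>b\<close>: the powers of
  the irrelevant ideal multiply.
\<close>

lemma forms_add_subset_ideal:
  fixes K :: "('v, 'k::comm_ring_1) mpoly set"
  assumes K: "ideal K poly_ring"
    and prod: "\<And>f g. f \<in> forms a \<Longrightarrow> g \<in> forms b \<Longrightarrow> f * g \<in> K"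
  shows "forms (a + b) \<subseteq> K"
proof
  fix f :: "('v, 'k) mpoly" assume "f \<in> forms (a + b)"
  then show "f \<in> K"
  proof (induction rule: forms_induct)
    case (single m c)
    then obtain m1 m2 where m: "m = m1 + m2" "monom_deg m1 = a" "monom_deg m2 = b"
      by (rule monom_deg_split)
    then have "Poly_Mapping.single m c = Poly_Mapping.single m1 c * Mon m2"
      by (simp add: mult_single)
    with m show ?case by (auto intro: prod single_in_forms)
  qed (auto intro: ideal_zero[OF K] ideal_add[OF K])
qed

lemma forms_subset_ideal_mono:
  fixes K :: "('v, 'k::comm_ring_1) mpoly set"
  assumes "ideal K poly_ring" "forms m \<subseteq> K" "m \<le> n"
  shows "forms n \<subseteq> K"
  using forms_add_subset_ideal[OF assms(1), of m "n - m"] assms(2,3)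
  by (auto intro: ideal_mult_right[OF assms(1)])

lemma lookup_hom_component:
  "Poly_Mapping.lookup (hom_component d f) m = (if monom_deg m = d then Poly_Mapping.lookup f m else 0)"
proof -
  have "Poly_Mapping.lookup (hom_component d f) m
      = (\<Sum>k\<in>{k \<in> Poly_Mapping.keys f. monom_deg k = d}. if k = m then Poly_Mapping.lookup f m else 0)"
    unfolding hom_component_def lookup_sum
    by (rule sum.cong) (auto simp: lookup_single when_def)
  then show ?thesis by (auto simp: in_keys_iff)
qed

lemma hom_component_in_forms [simp]: "hom_component d f \<in> forms d"
  by (simp add: forms_iff_lookup lookup_hom_component)

lemma hom_component_form: "f \<in> forms e \<Longrightarrow> hom_component d f = (if d = e then f else 0)"
  by (rule poly_mapping_eqI) (auto simp: lookup_hom_component forms_iff_lookup)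

lemma hom_component_add: "hom_component d (f + g) = hom_component d f + hom_component d g"
  and hom_component_zero [simp]: "hom_component d 0 = 0"
  by (auto intro!: poly_mapping_eqI simp: lookup_hom_component lookup_add)

lemma hom_component_mult_form:
  fixes f g :: "('v, 'k::comm_ring_1) mpoly"
  assumes "g \<in> forms e"
  shows "hom_component d (f * g) = (if e \<le> d then hom_component (d - e) f * g else 0)"
proof (induction f rule: mpoly_induct)
  case (single m c)
  have "Poly_Mapping.single m c * g \<in> forms (monom_deg m + e)"
    by (rule forms_mult[OF single_in_forms assms]) simp
  moreover have "Poly_Mapping.single m c \<in> forms (monom_deg m)"
    by (rule single_in_forms) simp
  ultimately show ?case by (auto simp: hom_component_form)
qed (auto simp: hom_component_add distrib_right)

lemma mpoly_eq_sum_hom_components: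
  fixes f :: "('v, 'k::comm_ring_1) mpoly"
  assumes "finite D" "\<And>m. m \<in> Poly_Mapping.keys f \<Longrightarrow> monom_deg m \<in> D"
  shows "f = (\<Sum>d\<in>D. hom_component d f)"
proof (rule poly_mapping_eqI)
  fix k show "Poly_Mapping.lookup f k = Poly_Mapping.lookup (\<Sum>d\<in>D. hom_component d f) k"
    using assms by (auto simp: lookup_sum lookup_hom_component in_keys_iff)
qed

lemma homogeneous_idealD:
  assumes "homogeneous_ideal I"
  shows "ideal I poly_ring" "f \<in> I \<Longrightarrow> hom_component d f \<in> I"
  using assms by (auto simp: homogeneous_ideal_def)

lemma homogeneous_ideal_adjoin:
  fixes I :: "('v, 'k::comm_ring_1) mpoly set"
  assumes I: "homogeneous_ideal I" and f: "f \<in> forms e"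
  shows "homogeneous_ideal (adjoin I f)"
  unfolding homogeneous_ideal_def
proof (intro conjI ballI allI ideal_adjoin homogeneous_idealD[OF I])
  fix g d assume "g \<in> adjoin I f"
  then obtain a r where *: "a \<in> I" "g = a + r * f" by (auto elim: adjoinE)
  show "hom_component d g \<in> adjoin I f"
    by (rule adjoinI[of "hom_component d a" _ _ "if e \<le> d then hom_component (d - e) r else 0"])
      (use * in \<open>auto simp: hom_component_add hom_component_mult_form[OF f] homogeneous_idealD(2)[OF I]\<close>)
qed

lemma form_in_adjoinE:
  fixes I :: "('v, 'k::comm_ring_1) mpoly set"
  assumes I: "homogeneous_ideal I" and f: "f \<in> forms e" and g: "g \<in> adjoin I f" "g \<in> forms d"
  obtains a r where "a \<in> I" "a \<in> forms d" "r \<in> forms (d - e)" "g = a + r * f" "d < e \<longrightarrow> r = 0"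
proof -
  from g(1) obtain a r where *: "a \<in> I" "g = a + r * f" by (auto elim: adjoinE)
  let ?r = "if e \<le> d then hom_component (d - e) r else 0"
  have "g = hom_component d g" using g(2) by (simp add: hom_component_form)
  also have "\<dots> = hom_component d a + ?r * f"
    using *(2) by (simp add: hom_component_add hom_component_mult_form[OF f])
  finally show ?thesis
    using that[of "hom_component d a" ?r] * by (auto simp: homogeneous_idealD(2)[OF I])
qed

text \<open>
  Primality of a homogeneous ideal is visible on forms: if \<open>f\<close> and \<open>g\<close> lie outside, take in each
  the component of largest degree outside the ideal; the product of these two is, modulo the ideal,
  a component of \<open>f * g\<close>.
\<close>

lemma primeideal_if_prime_on_forms:
  fixes I :: "('v, 'k::comm_ring_1) mpoly set"
  assumes I: "homogeneous_ideal I" and one: "1 \<notin> I"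
    and prime: "\<And>f g a b. f \<in> forms a \<Longrightarrow> g \<in> forms b \<Longrightarrow> f * g \<in> I \<Longrightarrow> f \<in> I \<or> g \<in> I"
  shows "primeideal I poly_ring"
proof (rule primeidealI)
  note Id = homogeneous_idealD(1)[OF I]
  show "ideal I poly_ring" by (fact Id)
  show "cring (poly_ring :: ('v, 'k) mpoly ring)" by (rule cring_poly_ring)
  show "carrier poly_ring \<noteq> I" using one by auto
  \<comment> \<open>cut \<open>f\<close> off above the largest degree \<open>a\<close> in which its component lies outside \<open>I\<close>\<close>
  have top: "\<exists>f' a. f - f' \<in> I \<and> hom_component a f' \<notin> I \<and> (\<forall>m\<in>Poly_Mapping.keys f'. monom_deg m \<le> a)"
    if "f \<notin> I" for f
  proof -
    let ?D = "monom_deg ` Poly_Mapping.keys f"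
    let ?B = "{d \<in> ?D. hom_component d f \<notin> I}"
    have f: "f = (\<Sum>d\<in>?D. hom_component d f)"
      by (rule mpoly_eq_sum_hom_components) auto
    have "?B \<noteq> {}"
      using that f ideal_sum[OF Id, of ?D "\<lambda>d. hom_component d f"] by auto
    then have a: "Max ?B \<in> ?B" by (intro Max_in) auto
    define a where "a = Max ?B"
    have le: "d \<le> a" if "d \<in> ?B" for d using that by (simp add: a_def)
    define f' where "f' = (\<Sum>d\<in>{d\<in>?D. d \<le> a}. hom_component d f)"
    have lk: "Poly_Mapping.lookup f' m = (if monom_deg m \<le> a then Poly_Mapping.lookup f m else 0)" for m
      by (auto simp: f'_def lookup_sum lookup_hom_component in_keys_iff)
    have "f - f' = (\<Sum>d\<in>{d\<in>?D. \<not> d \<le> a}. hom_component d f)"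
    proof (rule poly_mapping_eqI)
      fix m show "Poly_Mapping.lookup (f - f') m = Poly_Mapping.lookup (\<Sum>d\<in>{d\<in>?D. \<not> d \<le> a}. hom_component d f) m"
        by (auto simp: lookup_minus lk lookup_sum lookup_hom_component in_keys_iff)
    qed
    moreover have "\<dots> \<in> I" by (rule ideal_sum[OF Id]) (use le in blast)
    moreover have "hom_component a f' = hom_component a f"
      by (rule poly_mapping_eqI) (simp add: lookup_hom_component lk)
    moreover have "\<forall>m\<in>Poly_Mapping.keys f'. monom_deg m \<le> a"
      by (auto simp: in_keys_iff lk split: if_splits)
    ultimately show ?thesis
      using a[folded a_def] by (intro exI[of _ f'] exI[of _ a]) auto
  qed
  fix f g :: "('v, 'k) mpoly"
  assume "f \<otimes>\<^bsub>poly_ring\<^esub> g \<in> I"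
  then have fg: "f * g \<in> I" by simp
  show "f \<in> I \<or> g \<in> I"
  proof (rule ccontr)
    assume "\<not> (f \<in> I \<or> g \<in> I)"
    then obtain f' a g' b where f': "f - f' \<in> I" "hom_component a f' \<notin> I" "\<forall>m\<in>Poly_Mapping.keys f'. monom_deg m \<le> a"
      and g': "g - g' \<in> I" "hom_component b g' \<notin> I" "\<forall>m\<in>Poly_Mapping.keys g'. monom_deg m \<le> b"
      using top[of f] top[of g] by blast
    have "f' * g' = f * g - (f - f') * g - f' * (g - g')" by (simp add: algebra_simps)
    also have "\<dots> \<in> I"
      by (intro ideal_diff[OF Id] fg ideal_mult[OF Id g'(1)] ideal_mult_right[OF Id f'(1)])
    finally have *: "hom_component (a + b) (f' * g') \<in> I" by (rule homogeneous_idealD(2)[OF I])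
    have "hom_component (a + b) (f' * g') = hom_component a f' * hom_component b g'"
    proof -
      have F: "f' = (\<Sum>d\<le>a. hom_component d f')" and G: "g' = (\<Sum>d\<le>b. hom_component d g')"
        by (rule mpoly_eq_sum_hom_components; use f'(3) g'(3) in auto)+
      have sum: "hom_component c (sum h A) = (\<Sum>d\<in>A. hom_component c (h d))" 
        for c and h :: "nat \<Rightarrow> ('v, 'k) mpoly" and A
        by (induction A rule: infinite_finite_induct) (auto simp: hom_component_add)
      have "hom_component (a + b) (f' * g')
          = hom_component (a + b) (\<Sum>d\<le>b. f' * hom_component d g')"
        by (subst G) (simp only: sum_distrib_left)
      also have "\<dots> = (\<Sum>d\<le>b. hom_component (a + b - d) f' * hom_component d g')"
        unfolding sum by (rule sum.cong) (auto simp: hom_component_mult_form[OF hom_component_in_forms])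
      also have "\<dots> = (\<Sum>d\<le>b. if d = b then hom_component a f' * hom_component b g' else 0)"
      proof (rule sum.cong[OF refl])
        fix d assume "d \<in> {..b}"
        moreover have "hom_component (a + b - d) f' = 0" if "d < b"
        proof (rule poly_mapping_eqI)
          fix k
          have "k \<notin> Poly_Mapping.keys f'" if "monom_deg k = a + b - d"
            using f'(3) that \<open>d < b\<close> by fastforce
          then show "Poly_Mapping.lookup (hom_component (a + b - d) f') k = Poly_Mapping.lookup 0 k"
            by (simp add: lookup_hom_component in_keys_iff)
        qed
        ultimately show "hom_component (a + b - d) f' * hom_component d g'
            = (if d = b then hom_component a f' * hom_component b g' else 0)"
          by (cases "d = b") auto
      qed
      finally show ?thesis by simp
    qed
    with * prime[of "hom_component a f'" a "hom_component b g'" b] f'(2) g'(2) show False by simp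
  qed
qed

section \<open>Polynomial functions and Zariski neighbourhoods\<close>

definition monom_val :: "('v \<Rightarrow>\<^sub>0 nat) \<Rightarrow> ('v \<Rightarrow> 'k::comm_ring_1) \<Rightarrow> 'k" where
  "monom_val m a = (\<Prod>v\<in>Poly_Mapping.keys m. a v ^ Poly_Mapping.lookup m v)"

lemma monom_val_superset:
  assumes "finite A" "Poly_Mapping.keys m \<subseteq> A"
  shows "monom_val m a = (\<Prod>v\<in>A. a v ^ Poly_Mapping.lookup m v)"
  unfolding monom_val_def using assms
  by (intro prod.mono_neutral_left) (auto simp: in_keys_iff)

lemma monom_val_add: "monom_val (m + n) a = monom_val m a * monom_val n a"
proof -
  let ?A = "Poly_Mapping.keys m \<union> Poly_Mapping.keys n"
  have "monom_val (m + n) a = (\<Prod>v\<in>?A. a v ^ Poly_Mapping.lookup (m + n) v)"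
    by (rule monom_val_superset) (use Poly_Mapping.keys_add[of m n] in auto)
  then show ?thesis
    by (simp add: lookup_add power_add prod.distrib monom_val_superset[of ?A m] monom_val_superset[of ?A n])
qed

lemma eval_mpoly_superset:
  assumes "finite A" "Poly_Mapping.keys p \<subseteq> A"
  shows "eval_mpoly p a = (\<Sum>m\<in>A. Poly_Mapping.lookup p m * monom_val m a)"
  unfolding eval_mpoly_def monom_val_def using assms
  by (intro sum.mono_neutral_left) (auto simp: in_keys_iff)

lemma eval_mpoly_0 [simp]: "eval_mpoly 0 a = 0"
  by (simp add: eval_mpoly_def)

lemma eval_mpoly_add [simp]: "eval_mpoly (p + q) a = eval_mpoly p a + eval_mpoly q a"
proof -
  let ?A = "Poly_Mapping.keys p \<union> Poly_Mapping.keys q"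
  have "eval_mpoly (p + q) a = (\<Sum>m\<in>?A. Poly_Mapping.lookup (p + q) m * monom_val m a)"
    by (rule eval_mpoly_superset) (use Poly_Mapping.keys_add[of p q] in auto)
  then show ?thesis
    by (simp add: lookup_add distrib_right sum.distrib eval_mpoly_superset[of ?A p] eval_mpoly_superset[of ?A q])
qed

lemma eval_mpoly_single: "eval_mpoly (Poly_Mapping.single m c) a = c * monom_val m a"
  by (subst eval_mpoly_superset[of "{m}"]) auto

lemma eval_mpoly_Const [simp]: "eval_mpoly (Const c) a = c"
  by (simp add: eval_mpoly_single monom_val_def)

lemma eval_mpoly_1 [simp]: "eval_mpoly 1 a = 1"
  using eval_mpoly_Const[of 1 a] by simp

lemma eval_mpoly_Var [simp]: "eval_mpoly (Var v) a = a v"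
  by (simp add: eval_mpoly_single monom_val_def)

lemma eval_mpoly_mult [simp]:
  fixes p q :: "('v, 'k::comm_ring_1) mpoly"
  shows "eval_mpoly (p * q) a = eval_mpoly p a * eval_mpoly q a"
proof (induction p rule: mpoly_induct)
  case (single m c)
  show ?case
    by (induction q rule: mpoly_induct)
      (simp_all add: mult_single eval_mpoly_single monom_val_add algebra_simps)
qed (simp_all add: distrib_right)

lemma eval_mpoly_minus [simp]:
  fixes p :: "('v, 'k::comm_ring_1) mpoly"
  shows "eval_mpoly (- p) a = - eval_mpoly p a"
  using eval_mpoly_add[of p "- p" a] by (simp add: add_eq_0_iff)

lemma eval_mpoly_diff [simp]:
  fixes p :: "('v, 'k::comm_ring_1) mpoly"
  shows "eval_mpoly (p - q) a = eval_mpoly p a - eval_mpoly q a"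
  using eval_mpoly_add[of p "- q" a] by simp

definition polynomial_fun :: "(('v \<Rightarrow> 'k::comm_ring_1) \<Rightarrow> 'k) \<Rightarrow> bool" where
  "polynomial_fun \<phi> \<longleftrightarrow> (\<exists>p. \<forall>a. \<phi> a = eval_mpoly p a)"

lemma polynomial_fun_const: "polynomial_fun (\<lambda>_. c)"
  unfolding polynomial_fun_def by (rule exI[of _ "Const c"]) simp

lemma polynomial_fun_coord: "polynomial_fun (\<lambda>a. a v)"
  unfolding polynomial_fun_def by (rule exI[of _ "Var v"]) simp

lemma polynomial_fun_add: "polynomial_fun \<phi> \<Longrightarrow> polynomial_fun \<psi> \<Longrightarrow> polynomial_fun (\<lambda>a. \<phi> a + \<psi> a)"
  unfolding polynomial_fun_def by (metis eval_mpoly_add)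

lemma polynomial_fun_mult: "polynomial_fun \<phi> \<Longrightarrow> polynomial_fun \<psi> \<Longrightarrow> polynomial_fun (\<lambda>a. \<phi> a * \<psi> a)"
  unfolding polynomial_fun_def by (metis eval_mpoly_mult)

lemma polynomial_fun_diff: "polynomial_fun \<phi> \<Longrightarrow> polynomial_fun \<psi> \<Longrightarrow> polynomial_fun (\<lambda>a. \<phi> a - \<psi> a)"
  unfolding polynomial_fun_def by (metis eval_mpoly_diff)

lemma polynomial_fun_sum:
  "(\<And>i. i \<in> A \<Longrightarrow> polynomial_fun (\<phi> i)) \<Longrightarrow> polynomial_fun (\<lambda>a. \<Sum>i\<in>A. \<phi> i a)"
  by (induction A rule: infinite_finite_induct) (auto intro: polynomial_fun_const polynomial_fun_add)

lemma eval_mpoly_on_curve: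
  fixes p :: "('v, 'k::field) mpoly"
  assumes "\<And>v. \<exists>q. \<forall>u. c u v = poly q u"
  shows "\<exists>q. \<forall>u. eval_mpoly p (c u) = poly q u"
proof -
  obtain q where q: "c u v = poly (q v) u" for u v using assms by metis
  show ?thesis
    unfolding eval_mpoly_def
    by (rule exI[of _ "\<Sum>m\<in>Poly_Mapping.keys p. [:Poly_Mapping.lookup p m:] *
        (\<Prod>v\<in>Poly_Mapping.keys m. q v ^ Poly_Mapping.lookup m v)"])
       (simp add: q poly_sum poly_prod)
qed

lemma finite_zeros_on_curve:
  fixes p :: "('v, 'k::field) mpoly"
  assumes "\<And>v. \<exists>q. \<forall>u. c u v = poly q u" "eval_mpoly p (c u0) \<noteq> 0"
  shows "finite {u. eval_mpoly p (c u) = 0}"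
proof -
  obtain q where q: "eval_mpoly p (c u) = poly q u" for u
    using eval_mpoly_on_curve[of c p] assms(1) by metis
  with assms(2) have "q \<noteq> 0" by auto
  then show ?thesis by (simp add: q poly_roots_finite)
qed

text \<open>
  Linear independence of finitely many vectors whose entries are polynomial functions is an open
  condition. Gaussian elimination shows it: clear the column of a nonzero entry of the first row
  without dividing, so that the entries remain polynomial functions, and use induction.
  Infinitely many columns are allowed: below, elements of ideals and functionals index them.
\<close>

lemma rows_independent_near:
  fixes M :: "'i \<Rightarrow> 'e \<Rightarrow> ('v \<Rightarrow> 'k::field) \<Rightarrow> 'k"
  assumes "finite B" "\<And>i e. polynomial_fun (M i e)"
    and "\<And>c. (\<And>e. e \<in> E \<Longrightarrow> (\<Sum>i\<in>B. c i * M i e a0) = 0) \<Longrightarrow> \<forall>i\<in>B. c i = 0"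
  shows "\<exists>p. eval_mpoly p a0 \<noteq> 0 \<and> (\<forall>a c. eval_mpoly p a \<noteq> 0 \<longrightarrow>
    (\<forall>e\<in>E. (\<Sum>i\<in>B. c i * M i e a) = 0) \<longrightarrow> (\<forall>i\<in>B. c i = 0))"
  using assms
proof (induction B arbitrary: M rule: finite_induct)
  case empty
  then show ?case by (intro exI[of _ 1]) simp
next
  case (insert j B)
  have sum_insert: "(\<Sum>i\<in>insert j B. f i) = f j + (\<Sum>i\<in>B. f i)" for f :: "'i \<Rightarrow> 'k"
    using insert.hyps by simp
  have "\<exists>e0\<in>E. M j e0 a0 \<noteq> 0"
  proof (rule ccontr)
    assume *: "\<not> ?thesis"
    have "\<forall>i\<in>insert j B. (if i = j then 1 else 0) = (0::'k)"
    proof (rule insert.prems(2))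
      fix e assume "e \<in> E"
      moreover have "(\<Sum>i\<in>B. (if i = j then 1 else 0) * M i e a0) = 0"
        by (rule sum.neutral) (use insert.hyps in auto)
      ultimately show "(\<Sum>i\<in>insert j B. (if i = j then 1 else 0) * M i e a0) = 0"
        using * by (simp add: sum_insert)
    qed
    then show False by simp
  qed
  then obtain e0 where e0: "e0 \<in> E" "M j e0 a0 \<noteq> 0" by blast
  \<comment> \<open>the rows after elimination of the column \<open>e0\<close>, scaled by the pivot \<open>M j e0\<close>\<close>
  define N where "N i e a = M j e0 a * M i e a - M i e0 a * M j e a" for i e a
  have N_sum: "(\<Sum>i\<in>B. c i * N i e a) = M j e0 a * (\<Sum>i\<in>B. c i * M i e a) - (\<Sum>i\<in>B. c i * M i e0 a) * M j e a"
    for c e a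
    by (simp add: N_def sum_distrib_left sum_distrib_right algebra_simps flip: sum_subtractf)
  have "polynomial_fun (N i e)" for i e
    unfolding N_def[abs_def] by (intro polynomial_fun_diff polynomial_fun_mult insert.prems(1))
  moreover have "\<forall>i\<in>B. c i = 0" if *: "\<And>e. e \<in> E \<Longrightarrow> (\<Sum>i\<in>B. c i * N i e a0) = 0" for c
  proof -
    \<comment> \<open>a relation between the new rows, rewritten as one between the old rows\<close>
    define c' where "c' i = (if i = j then - (\<Sum>i\<in>B. c i * M i e0 a0) else c i * M j e0 a0)" for i
    have "\<forall>i\<in>insert j B. c' i = 0"
    proof (rule insert.prems(2))
      fix e assume e: "e \<in> E"
      have "(\<Sum>i\<in>B. c' i * M i e a0) = M j e0 a0 * (\<Sum>i\<in>B. c i * M i e a0)"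
        unfolding sum_distrib_left using insert.hyps by (intro sum.cong) (auto simp: c'_def)
      then show "(\<Sum>i\<in>insert j B. c' i * M i e a0) = 0"
        using *[OF e] by (simp add: sum_insert N_sum c'_def)
    qed
    with e0 insert.hyps show ?thesis by (auto simp: c'_def split: if_splits)
  qed
  ultimately obtain p where p: "eval_mpoly p a0 \<noteq> 0"
    "\<And>a c. eval_mpoly p a \<noteq> 0 \<Longrightarrow> (\<forall>e\<in>E. (\<Sum>i\<in>B. c i * N i e a) = 0) \<Longrightarrow> (\<forall>i\<in>B. c i = 0)"
    using insert.IH[of N] by blast
  obtain q where q: "\<And>a. M j e0 a = eval_mpoly q a"
    using insert.prems(1)[of j e0] by (auto simp: polynomial_fun_def)
  show ?case
  proof (intro exI[of _ "q * p"] conjI allI impI)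
    show "eval_mpoly (q * p) a0 \<noteq> 0" using p(1) e0 q by simp
  next
    fix a c assume a: "eval_mpoly (q * p) a \<noteq> 0"
      and c: "\<forall>e\<in>E. (\<Sum>i\<in>insert j B. c i * M i e a) = 0"
    have M: "(\<Sum>i\<in>B. c i * M i e a) = - (c j * M j e a)" if "e \<in> E" for e
      using c that by (simp add: sum_insert eq_neg_iff_add_eq_0 add.commute)
    have "\<forall>e\<in>E. (\<Sum>i\<in>B. c i * N i e a) = 0"
      using M e0(1) by (simp add: N_sum M algebra_simps)
    with a p(2)[of a c] have B: "\<forall>i\<in>B. c i = 0" by simp
    then have "c j * M j e0 a = 0" using M[OF e0(1)] by (simp add: minus_equation_iff)
    with a B show "\<forall>i\<in>insert j B. c i = 0" by (auto simp: q)
  qed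
qed

text \<open>
  The form \<open>G0\<close> is part of the notion because neighbourhoods of one form have that form in common,
  so that their finite intersections are visibly nonempty.
\<close>

definition zariski_near :: "nat \<Rightarrow> ('v, 'k::comm_ring_1) mpoly \<Rightarrow> (('v, 'k) mpoly \<Rightarrow> bool) \<Rightarrow> bool" where
  "zariski_near d G0 P \<longleftrightarrow> (\<exists>p. eval_mpoly p (Poly_Mapping.lookup G0) \<noteq> 0 \<and>
    (\<forall>G\<in>forms d. eval_mpoly p (Poly_Mapping.lookup G) \<noteq> 0 \<longrightarrow> P G))"

lemma zariski_near_always: "(\<And>G. G \<in> forms d \<Longrightarrow> P G) \<Longrightarrow> zariski_near d G0 P"
  unfolding zariski_near_def by (rule exI[of _ 1]) simp

lemma zariski_near_mono:
  "zariski_near d G0 P \<Longrightarrow> (\<And>G. G \<in> forms d \<Longrightarrow> P G \<Longrightarrow> Q G) \<Longrightarrow> zariski_near d G0 Q"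
  unfolding zariski_near_def by blast

lemma zariski_near_conj:
  fixes G0 :: "('v, 'k::idom) mpoly"
  assumes "zariski_near d G0 P" "zariski_near d G0 Q"
  shows "zariski_near d G0 (\<lambda>G. P G \<and> Q G)"
proof -
  from assms obtain p q where "eval_mpoly p (Poly_Mapping.lookup G0) \<noteq> 0"
    "eval_mpoly q (Poly_Mapping.lookup G0) \<noteq> 0"
    "\<And>G. G \<in> forms d \<Longrightarrow> eval_mpoly p (Poly_Mapping.lookup G) \<noteq> 0 \<Longrightarrow> P G"
    "\<And>G. G \<in> forms d \<Longrightarrow> eval_mpoly q (Poly_Mapping.lookup G) \<noteq> 0 \<Longrightarrow> Q G"
    unfolding zariski_near_def by blast
  then show ?thesis unfolding zariski_near_def by (intro exI[of _ "p * q"]) simp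
qed

lemma zariski_near_ball:
  fixes G0 :: "('v, 'k::idom) mpoly"
  assumes "finite A" "\<And>i. i \<in> A \<Longrightarrow> zariski_near d G0 (P i)"
  shows "zariski_near d G0 (\<lambda>G. \<forall>i\<in>A. P i G)"
  using assms by (induction A) (auto intro: zariski_near_always zariski_near_conj)

lemma for_general_form_if_near:
  assumes "G0 \<in> forms d" "zariski_near d G0 P"
  shows "for_general_form d P"
proof -
  from assms(2) obtain p where p: "eval_mpoly p (Poly_Mapping.lookup G0) \<noteq> 0"
    "\<And>G. G \<in> forms d \<Longrightarrow> eval_mpoly p (Poly_Mapping.lookup G) \<noteq> 0 \<Longrightarrow> P G"
    unfolding zariski_near_def by blast
  show ?thesis unfolding for_general_form_def
  proof (intro exI[of _ "{F \<in> forms d. \<exists>q\<in>{p}. eval_mpoly q (Poly_Mapping.lookup F) \<noteq> 0}"] conjI)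
    show "zariski_open_forms d {F \<in> forms d. \<exists>q\<in>{p}. eval_mpoly q (Poly_Mapping.lookup F) \<noteq> 0}"
      unfolding zariski_open_forms_def by blast
  qed (use assms(1) p in auto)
qed

text \<open>
  Nonempty open subsets of an affine space over an infinite field meet: on the line joining a
  point of one to a point of the other, each of them omits only finitely many points.
\<close>

lemma for_general_form_if_near_two:
  fixes F1 F2 :: "('v, 'k::field) mpoly"
  assumes inf: "infinite (UNIV :: 'k set)"
    and F: "F1 \<in> forms d" "F2 \<in> forms d"
    and P: "zariski_near d F1 P" and Q: "zariski_near d F2 Q"
  shows "for_general_form d (\<lambda>F. P F \<and> Q F)"
proof -
  from P obtain p where p: "eval_mpoly p (Poly_Mapping.lookup F1) \<noteq> 0"
    "\<And>G. G \<in> forms d \<Longrightarrow> eval_mpoly p (Poly_Mapping.lookup G) \<noteq> 0 \<Longrightarrow> P G"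
    unfolding zariski_near_def by blast
  from Q obtain q where q: "eval_mpoly q (Poly_Mapping.lookup F2) \<noteq> 0"
    "\<And>G. G \<in> forms d \<Longrightarrow> eval_mpoly q (Poly_Mapping.lookup G) \<noteq> 0 \<Longrightarrow> Q G"
    unfolding zariski_near_def by blast
  define c where "c u = F1 + Const u * (F2 - F1)" for u
  have c: "\<exists>r. \<forall>u. Poly_Mapping.lookup (c u) v = poly r u" for v
    by (rule exI[of _ "[:Poly_Mapping.lookup F1 v, Poly_Mapping.lookup (F2 - F1) v:]"])
       (simp add: c_def lookup_add)
  have "finite {u. eval_mpoly p (Poly_Mapping.lookup (c u)) = 0}"
    by (rule finite_zeros_on_curve[where ?u0.0 = 0]) (use c p(1) in \<open>auto simp: c_def\<close>)
  moreover have "finite {u. eval_mpoly q (Poly_Mapping.lookup (c u)) = 0}"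
    by (rule finite_zeros_on_curve[where ?u0.0 = 1]) (use c q(1) in \<open>auto simp: c_def\<close>)
  ultimately have "finite ({u. eval_mpoly p (Poly_Mapping.lookup (c u)) = 0}
      \<union> {u. eval_mpoly q (Poly_Mapping.lookup (c u)) = 0})" by blast
  with inf obtain u where u: "u \<notin> {u. eval_mpoly p (Poly_Mapping.lookup (c u)) = 0}
      \<union> {u. eval_mpoly q (Poly_Mapping.lookup (c u)) = 0}"
    using ex_new_if_finite by blast
  have "c u \<in> forms d" unfolding c_def by (intro forms_add forms_Const_mult forms_diff F)
  then show ?thesis
  proof (rule for_general_form_if_near)
    show "zariski_near d (c u) (\<lambda>F. P F \<and> Q F)"
    proof (rule zariski_near_conj)
      show "zariski_near d (c u) P" unfolding zariski_near_def using u p(2) by blast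
      show "zariski_near d (c u) Q" unfolding zariski_near_def using u q(2) by blast
    qed
  qed
qed

section \<open>Maximal rank is an open condition\<close>

definition linear_functional :: "(('v, 'k::comm_ring_1) mpoly \<Rightarrow> 'k) \<Rightarrow> bool" where
  "linear_functional \<Lambda> \<longleftrightarrow> (\<forall>f g. \<Lambda> (f + g) = \<Lambda> f + \<Lambda> g) \<and> (\<forall>c f. \<Lambda> (Const c * f) = c * \<Lambda> f)"

lemma linear_functional_zero:
  assumes "linear_functional \<Lambda>" shows "\<Lambda> 0 = 0"
  using assms unfolding linear_functional_def by (metis mult_zero_left single_zero)

lemma linear_functional_sum:
  assumes "linear_functional \<Lambda>" shows "\<Lambda> (\<Sum>i\<in>A. Const (c i) * f i) = (\<Sum>i\<in>A. c i * \<Lambda> (f i))"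
  by (induction A rule: infinite_finite_induct)
     (use assms in \<open>auto simp: linear_functional_zero linear_functional_def\<close>)

lemma separating_functional:
  fixes K :: "('v, 'k::field) mpoly set"
  assumes K: "ideal K poly_ring" and g: "g \<notin> K"
  obtains \<Lambda> where "linear_functional \<Lambda>" "\<And>f. f \<in> K \<Longrightarrow> \<Lambda> f = 0" "\<Lambda> g \<noteq> 0"
proof -
  interpret vector_space_pair "\<lambda>c (f :: ('v, 'k) mpoly). Const c * f" "(*) :: 'k \<Rightarrow> 'k \<Rightarrow> 'k"
    by unfold_locales (simp_all add: single_add distrib_left distrib_right mult_single flip: mult.assoc)
  have "vs1.subspace K"
    by (auto simp: vs1.subspace_def ideal_zero[OF K] ideal_add[OF K] ideal_mult[OF K])
  then obtain B where B: "B \<subseteq> K" "vs1.independent B" "vs1.span B = K"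
    using vs1.maximal_independent_subset[of K] vs1.span_minimal by (metis subset_antisym)
  then have "g \<notin> vs1.span B" "g \<notin> B" using g by auto
  with B(2) have "vs1.independent (insert g B)" by (intro vs1.independent_insertI)
  then obtain \<Lambda> where \<Lambda>: "Vector_Spaces.linear (\<lambda>c f. Const c * f) (*) \<Lambda>" "\<forall>x\<in>insert g B. \<Lambda> x = (if x = g then 1 else 0)"
    using linear_independent_extend[of "insert g B" "\<lambda>x. if x = g then 1 else 0"] by blast
  interpret \<Lambda>: Vector_Spaces.linear "\<lambda>c f. Const c * f" "(*)" \<Lambda> by fact
  show ?thesis
  proof (rule that)
    show "linear_functional \<Lambda>"
      by (simp add: linear_functional_def \<Lambda>.add \<Lambda>.scale)
    show "\<Lambda> g \<noteq> 0" using \<Lambda>(2) by simp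
    show "\<Lambda> f = 0" if "f \<in> K" for f
    proof -
      have "\<Lambda> x = 0" if "x \<in> B" for x using \<Lambda>(2) that \<open>g \<notin> B\<close> by auto
      moreover have "f \<in> vs1.span B" using that B(3) by simp
      ultimately show ?thesis using \<Lambda>.eq_0_on_span by blast
    qed
  qed
qed

text \<open>
  On forms of a fixed degree a linear functional of a product is a linear function of the
  coefficients of one factor.
\<close>

definition functional_of_mult :: "nat \<Rightarrow> (('v, 'k::comm_ring_1) mpoly \<Rightarrow> 'k) \<Rightarrow> ('v, 'k) mpoly \<Rightarrow>
    (('v \<Rightarrow>\<^sub>0 nat) \<Rightarrow> 'k) \<Rightarrow> 'k" where
  "functional_of_mult d \<Lambda> h a = (\<Sum>m\<in>monoms_of_deg d. a m * \<Lambda> (Mon m * h))"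

lemma polynomial_fun_functional_of_mult: "polynomial_fun (functional_of_mult d \<Lambda> h)"
  unfolding functional_of_mult_def[abs_def]
  by (intro polynomial_fun_sum polynomial_fun_mult polynomial_fun_coord polynomial_fun_const)

lemma functional_of_mult_lookup:
  fixes G :: "('v::finite, 'k::comm_ring_1) mpoly"
  assumes "linear_functional \<Lambda>" "G \<in> forms d"
  shows "functional_of_mult d \<Lambda> h (Poly_Mapping.lookup G) = \<Lambda> (G * h)"
proof -
  have "\<Lambda> (G * h) = \<Lambda> (\<Sum>m\<in>monoms_of_deg d. Const (Poly_Mapping.lookup G m) * (Mon m * h))"
    by (subst forms_eq_sum[OF assms(2)]) (simp only: sum_distrib_right mult.assoc)
  then show ?thesis by (simp only: functional_of_mult_def linear_functional_sum[OF assms(1)])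
qed

lemma linear_functional_lookup: "linear_functional (\<lambda>f. Poly_Mapping.lookup f m)"
  by (simp add: linear_functional_def lookup_add)

text \<open>
  Surjectivity in degree \<open>n\<close> fails at \<open>G\<close> exactly if a nonzero functional on the forms of degree
  \<open>n\<close> kills \<open>K\<close> and the multiples of \<open>G\<close>. The coefficients of such a functional solve a linear
  system depending polynomially on \<open>G\<close>, with one unknown for each monomial.
\<close>

lemma zariski_near_forms_subset_adjoin:
  fixes K :: "('v::finite, 'k::field) mpoly set"
  assumes K: "homogeneous_ideal K" and G0: "G0 \<in> forms d" and sub: "forms n \<subseteq> adjoin K G0"
  shows "zariski_near d G0 (\<lambda>G. forms n \<subseteq> adjoin K G)"
proof -
  note Kid = homogeneous_idealD(1)[OF K]
  let ?E = "{(a, b). a \<in> K \<and> a \<in> forms n \<and> b \<in> forms (n - d) \<and> (n < d \<longrightarrow> b = 0)}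
    :: (('v, 'k) mpoly \<times> ('v, 'k) mpoly) set"
  define M where "M m e a = Poly_Mapping.lookup (fst e) m
      + functional_of_mult d (\<lambda>f. Poly_Mapping.lookup f m) (snd e) a"
    for m and e :: "('v, 'k) mpoly \<times> ('v, 'k) mpoly" and a
  have M: "M m e (Poly_Mapping.lookup G) = Poly_Mapping.lookup (fst e + G * snd e) m"
    if "G \<in> forms d" for m e G
    using functional_of_mult_lookup[OF linear_functional_lookup that, of m "snd e"]
    by (simp add: M_def lookup_add)
  have "polynomial_fun (M m e)" for m e
    unfolding M_def[abs_def]
    by (intro polynomial_fun_add polynomial_fun_const polynomial_fun_functional_of_mult)
  moreover have "\<forall>m\<in>monoms_of_deg n. c m = 0"
    if c: "\<And>e. e \<in> ?E \<Longrightarrow> (\<Sum>m\<in>monoms_of_deg n. c m * M m e (Poly_Mapping.lookup G0)) = 0" for c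
  proof
    fix k :: "'v \<Rightarrow>\<^sub>0 nat" assume k: "k \<in> monoms_of_deg n"
    then have k': "Mon k \<in> forms n" by (auto simp: monoms_of_deg_def intro: single_in_forms)
    with sub have "Mon k \<in> adjoin K G0" by blast
    from form_in_adjoinE[OF K G0 this k'] obtain a r where *:
      "a \<in> K" "a \<in> forms n" "r \<in> forms (n - d)" "Mon k = a + r * G0" "n < d \<longrightarrow> r = 0" by metis
    then have "(\<Sum>m\<in>monoms_of_deg n. c m * M m (a, r) (Poly_Mapping.lookup G0)) = 0"
      by (intro c) auto
    also have "(\<Sum>m\<in>monoms_of_deg n. c m * M m (a, r) (Poly_Mapping.lookup G0))
        = (\<Sum>m\<in>monoms_of_deg n. c m * Poly_Mapping.lookup (Mon k) m)"
      unfolding *(4) by (simp add: M[OF G0] mult.commute)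
    also have "\<dots> = (\<Sum>m\<in>monoms_of_deg n. if m = k then c k else 0)"
      by (rule sum.cong) (auto simp: lookup_single when_def)
    finally show "c k = 0" using k by (simp add: finite_monoms_of_deg)
  qed
  ultimately have "\<exists>p. eval_mpoly p (Poly_Mapping.lookup G0) \<noteq> 0 \<and>
      (\<forall>a c. eval_mpoly p a \<noteq> 0 \<longrightarrow> (\<forall>e\<in>?E. (\<Sum>m\<in>monoms_of_deg n. c m * M m e a) = 0)
        \<longrightarrow> (\<forall>m\<in>monoms_of_deg n. c m = 0))"
    by (rule rows_independent_near[OF finite_monoms_of_deg])
  then obtain p where p: "eval_mpoly p (Poly_Mapping.lookup G0) \<noteq> 0"
    "\<forall>a c. eval_mpoly p a \<noteq> 0 \<longrightarrow> (\<forall>e\<in>?E. (\<Sum>m\<in>monoms_of_deg n. c m * M m e a) = 0)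
        \<longrightarrow> (\<forall>m\<in>monoms_of_deg n. c m = 0)"
    by (elim exE conjE)
  have "forms n \<subseteq> adjoin K G" if G: "G \<in> forms d" "eval_mpoly p (Poly_Mapping.lookup G) \<noteq> 0" for G
  proof (rule ccontr)
    assume "\<not> forms n \<subseteq> adjoin K G"
    then obtain g where g: "g \<in> forms n" "g \<notin> adjoin K G" by blast
    then obtain \<Lambda> where \<Lambda>: "linear_functional \<Lambda>" "\<And>f. f \<in> adjoin K G \<Longrightarrow> \<Lambda> f = 0" "\<Lambda> g \<noteq> 0"
      using separating_functional[OF ideal_adjoin[OF Kid]] by blast
    have \<Lambda>_sum: "\<Lambda> f = (\<Sum>m\<in>monoms_of_deg n. Poly_Mapping.lookup f m * \<Lambda> (Mon m))" if "f \<in> forms n" for f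
      using linear_functional_sum[OF \<Lambda>(1), of "Poly_Mapping.lookup f" Mon "monoms_of_deg n"]
      unfolding forms_eq_sum[OF that, symmetric] .
    have "\<forall>m\<in>monoms_of_deg n. \<Lambda> (Mon m) = 0"
    proof (rule p(2)[THEN spec, THEN spec, THEN mp, OF G(2), THEN mp], rule ballI)
      fix e assume e: "e \<in> ?E"
      have "snd e * G \<in> forms n"
      proof (cases "n < d")
        case False
        then show ?thesis using e forms_mult[of "snd e" "n - d" G d] G(1) by auto
      qed (use e in auto)
      then have "fst e + snd e * G \<in> forms n" using e by (auto intro: forms_add)
      then have "(\<Sum>m\<in>monoms_of_deg n. \<Lambda> (Mon m) * M m e (Poly_Mapping.lookup G)) = \<Lambda> (fst e + snd e * G)"
        by (simp add: M[OF G(1)] \<Lambda>_sum mult.commute)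
      also have "\<dots> = 0" by (rule \<Lambda>(2), rule adjoinI) (use e in auto)
      finally show "(\<Sum>m\<in>monoms_of_deg n. \<Lambda> (Mon m) * M m e (Poly_Mapping.lookup G)) = 0" .
    qed
    with \<Lambda>_sum[OF g(1)] \<Lambda>(3) show False by simp
  qed
  with p(1) show ?thesis unfolding zariski_near_def by blast
qed

lemma finite_basis_modulo:
  fixes K :: "('v, 'k::field) mpoly set"
  assumes K: "ideal K poly_ring" and "finite A"
  shows "\<exists>B\<subseteq>A. (\<forall>c. (\<Sum>m\<in>B. Const (c m) * Mon m) \<in> K \<longrightarrow> (\<forall>m\<in>B. c m = 0)) \<and>
    (\<forall>c. \<exists>c'. (\<Sum>m\<in>A. Const (c m) * Mon m) - (\<Sum>m\<in>B. Const (c' m) * Mon m) \<in> K)"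
  using assms(2)
proof induction
  case empty
  then show ?case by (auto simp: ideal_zero[OF K])
next
  case (insert k A)
  then obtain B where B: "B \<subseteq> A" "\<And>c. (\<Sum>m\<in>B. Const (c m) * Mon m) \<in> K \<Longrightarrow> \<forall>m\<in>B. c m = 0"
    "\<And>c. \<exists>c'. (\<Sum>m\<in>A. Const (c m) * Mon m) - (\<Sum>m\<in>B. Const (c' m) * Mon m) \<in> K" by blast
  have "k \<notin> B" "finite B" using B(1) insert.hyps finite_subset by auto
  show ?case
  proof (cases "\<exists>b. Mon k - (\<Sum>m\<in>B. Const (b m) * Mon m) \<in> K")
    case True
    then obtain b where b: "Mon k - (\<Sum>m\<in>B. Const (b m) * Mon m) \<in> K" by blast
    have "\<exists>c'. (\<Sum>m\<in>insert k A. Const (c m) * Mon m) - (\<Sum>m\<in>B. Const (c' m) * Mon m) \<in> K" for c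
    proof -
      obtain c' where c': "(\<Sum>m\<in>A. Const (c m) * Mon m) - (\<Sum>m\<in>B. Const (c' m) * Mon m) \<in> K" using B(3) by blast
      have "(\<Sum>m\<in>B. Const (c k * b m + c' m) * Mon m)
          = Const (c k) * (\<Sum>m\<in>B. Const (b m) * Mon m) + (\<Sum>m\<in>B. Const (c' m) * Mon m)"
        by (simp add: sum_distrib_left sum.distrib single_add distrib_right mult_single)
      then have "(\<Sum>m\<in>insert k A. Const (c m) * Mon m) - (\<Sum>m\<in>B. Const (c k * b m + c' m) * Mon m)
          = Const (c k) * (Mon k - (\<Sum>m\<in>B. Const (b m) * Mon m))
            + ((\<Sum>m\<in>A. Const (c m) * Mon m) - (\<Sum>m\<in>B. Const (c' m) * Mon m))"
        using insert.hyps by (simp add: algebra_simps)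
      also have "\<dots> \<in> K" by (intro ideal_add[OF K] ideal_mult[OF K] b c')
      finally show ?thesis by (intro exI[of _ "\<lambda>m. c k * b m + c' m"])
    qed
    with B(1,2) show ?thesis by (intro exI[of _ B]) blast
  next
    case False
    have "\<forall>m\<in>insert k B. c m = 0" if c: "(\<Sum>m\<in>insert k B. Const (c m) * Mon m) \<in> K" for c
    proof -
      have sum: "(\<Sum>m\<in>insert k B. Const (c m) * Mon m) = Const (c k) * Mon k + (\<Sum>m\<in>B. Const (c m) * Mon m)"
        using \<open>k \<notin> B\<close> \<open>finite B\<close> by simp
      have "c k = 0"
      proof (rule ccontr)
        assume ck: "c k \<noteq> 0"
        have "Const (inverse (c k)) * (\<Sum>m\<in>insert k B. Const (c m) * Mon m)
            = Mon k - (\<Sum>m\<in>B. Const (- (inverse (c k) * c m)) * Mon m)"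
          using ck \<open>k \<notin> B\<close> \<open>finite B\<close>
          by (simp add: distrib_left sum_distrib_left mult_single single_uminus sum_negf flip: mult.assoc)
        with ideal_mult[OF K c, of "Const (inverse (c k))"] False show False by auto
      qed
      with c B(2) sum show ?thesis by simp
    qed
    moreover have "\<exists>c'. (\<Sum>m\<in>insert k A. Const (c m) * Mon m) - (\<Sum>m\<in>insert k B. Const (c' m) * Mon m) \<in> K" for c
    proof -
      obtain c' where c': "(\<Sum>m\<in>A. Const (c m) * Mon m) - (\<Sum>m\<in>B. Const (c' m) * Mon m) \<in> K" using B(3) by blast
      have "(\<Sum>m\<in>B. Const ((c'(k := c k)) m) * Mon m) = (\<Sum>m\<in>B. Const (c' m) * Mon m)"
        using \<open>k \<notin> B\<close> by (intro sum.cong) auto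
      with c' show ?thesis using insert.hyps \<open>k \<notin> B\<close> \<open>finite B\<close> by (intro exI[of _ "c'(k := c k)"]) simp
    qed
    ultimately show ?thesis using B(1) by (intro exI[of _ "insert k B"]) blast
  qed
qed

text \<open>
  Injectivity in degree \<open>n\<close>, for the map \<open>R/K \<rightarrow> R/K\<close> given by \<open>G\<close>, says that the images of a basis
  of the forms of degree \<open>n\<close> modulo \<open>K\<close> are independent modulo \<open>K\<close>. The columns of the linear
  system are the functionals that vanish on \<open>K\<close>.
\<close>

lemma zariski_near_mult_injective:
  fixes K :: "('v::finite, 'k::field) mpoly set"
  assumes K: "ideal K poly_ring" and G0: "G0 \<in> forms d"
    and inj: "\<And>f. f \<in> forms n \<Longrightarrow> G0 * f \<in> K \<Longrightarrow> f \<in> K"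
  shows "zariski_near d G0 (\<lambda>G. \<forall>f\<in>forms n. G * f \<in> K \<longrightarrow> f \<in> K)"
proof -
  obtain B :: "('v \<Rightarrow>\<^sub>0 nat) set" where B: "B \<subseteq> monoms_of_deg n"
    "\<And>c. (\<Sum>m\<in>B. Const (c m) * Mon m) \<in> K \<Longrightarrow> \<forall>m\<in>B. c m = 0"
    "\<And>c. \<exists>c'. (\<Sum>m\<in>monoms_of_deg n. Const (c m) * Mon m) - (\<Sum>m\<in>B. Const (c' m) * Mon m) \<in> K"
    using finite_basis_modulo[OF K finite_monoms_of_deg, of n] by blast
  have B_fin: "finite B" by (rule finite_subset[OF B(1) finite_monoms_of_deg])
  let ?E = "{\<Lambda>. linear_functional \<Lambda> \<and> (\<forall>f\<in>K. \<Lambda> f = 0)}"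
  define M where "M m \<Lambda> = functional_of_mult d \<Lambda> (Mon m :: ('v, 'k) mpoly)" for m \<Lambda>
  have M: "(\<Sum>m\<in>B. c m * M m \<Lambda> (Poly_Mapping.lookup G)) = \<Lambda> (G * (\<Sum>m\<in>B. Const (c m) * Mon m))"
    if "\<Lambda> \<in> ?E" "G \<in> forms d" for c \<Lambda> and G :: "('v, 'k) mpoly"
  proof -
    have "\<Lambda> (G * (\<Sum>m\<in>B. Const (c m) * Mon m)) = \<Lambda> (\<Sum>m\<in>B. Const (c m) * (G * Mon m))"
      by (simp only: sum_distrib_left mult.left_commute)
    also have "\<dots> = (\<Sum>m\<in>B. c m * \<Lambda> (G * Mon m))"
      using that by (intro linear_functional_sum) simp
    finally show ?thesis using that by (simp add: M_def functional_of_mult_lookup)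
  qed
  have mem: "G * (\<Sum>m\<in>B. Const (c m) * Mon m) \<in> K \<longleftrightarrow>
      (\<forall>\<Lambda>\<in>?E. (\<Sum>m\<in>B. c m * M m \<Lambda> (Poly_Mapping.lookup G)) = 0)"
    if "G \<in> forms d" for c and G :: "('v, 'k) mpoly"
  proof
    assume "G * (\<Sum>m\<in>B. Const (c m) * Mon m) \<in> K"
    then show "\<forall>\<Lambda>\<in>?E. (\<Sum>m\<in>B. c m * M m \<Lambda> (Poly_Mapping.lookup G)) = 0"
      using M[OF _ that] by simp
  next
    assume *: "\<forall>\<Lambda>\<in>?E. (\<Sum>m\<in>B. c m * M m \<Lambda> (Poly_Mapping.lookup G)) = 0"
    show "G * (\<Sum>m\<in>B. Const (c m) * Mon m) \<in> K"
    proof (rule ccontr)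
      assume "\<not> ?thesis"
      then obtain \<Lambda> where \<Lambda>: "linear_functional \<Lambda>" "\<And>f. f \<in> K \<Longrightarrow> \<Lambda> f = 0"
        "\<Lambda> (G * (\<Sum>m\<in>B. Const (c m) * Mon m)) \<noteq> 0"
        using separating_functional[OF K] by blast
      then have "\<Lambda> \<in> ?E" by simp
      with \<Lambda>(3) * M[OF _ that] show False by simp
    qed
  qed
  have B_forms: "(\<Sum>m\<in>B. Const (c m) * Mon m) \<in> forms n" for c :: "_ \<Rightarrow> 'k"
    using B(1) by (intro forms_sum forms_Const_mult single_in_forms) (auto simp: monoms_of_deg_def)
  have "polynomial_fun (M m \<Lambda>)" for m \<Lambda>
    unfolding M_def by (rule polynomial_fun_functional_of_mult)
  moreover have "\<forall>m\<in>B. c m = 0"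
    if "\<And>\<Lambda>. \<Lambda> \<in> ?E \<Longrightarrow> (\<Sum>m\<in>B. c m * M m \<Lambda> (Poly_Mapping.lookup G0)) = 0" for c
    by (rule B(2), rule inj, rule B_forms) (use that mem[OF G0, of c] in blast)
  ultimately have "\<exists>p. eval_mpoly p (Poly_Mapping.lookup G0) \<noteq> 0 \<and>
      (\<forall>a c. eval_mpoly p a \<noteq> 0 \<longrightarrow> (\<forall>\<Lambda>\<in>?E. (\<Sum>m\<in>B. c m * M m \<Lambda> a) = 0)
        \<longrightarrow> (\<forall>m\<in>B. c m = 0))"
    by (rule rows_independent_near[OF B_fin])
  then obtain p where p: "eval_mpoly p (Poly_Mapping.lookup G0) \<noteq> 0"
    "\<forall>a c. eval_mpoly p a \<noteq> 0 \<longrightarrow> (\<forall>\<Lambda>\<in>?E. (\<Sum>m\<in>B. c m * M m \<Lambda> a) = 0)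
        \<longrightarrow> (\<forall>m\<in>B. c m = 0)"
    by (elim exE conjE)
  have "f \<in> K" if G: "G \<in> forms d" "eval_mpoly p (Poly_Mapping.lookup G) \<noteq> 0"
    and f: "f \<in> forms n" "G * f \<in> K" for G f
  proof -
    obtain c where c: "f - (\<Sum>m\<in>B. Const (c m) * Mon m) \<in> K"
      using B(3)[of "Poly_Mapping.lookup f"] unfolding forms_eq_sum[OF f(1), symmetric] by blast
    have "G * (\<Sum>m\<in>B. Const (c m) * Mon m) = G * f - G * (f - (\<Sum>m\<in>B. Const (c m) * Mon m))"
      by (simp only: right_diff_distrib) simp
    also have "\<dots> \<in> K" by (intro ideal_diff[OF K] f ideal_mult[OF K] c)
    finally have "\<forall>m\<in>B. c m = 0" 
      using mem[OF G(1), of c] p(2)[THEN spec, THEN spec, THEN mp, OF G(2), of c] by simp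
    with c show ?thesis by simp
  qed
  with p(1) show ?thesis unfolding zariski_near_def by blast
qed

section \<open>Linear nonzerodivisors modulo the ideal of a zeroscheme\<close>

lemma homogeneous_ideal_Union_chain:
  assumes C: "C \<noteq> {}" "\<And>J. J \<in> C \<Longrightarrow> homogeneous_ideal J"
    and chain: "\<And>J J'. J \<in> C \<Longrightarrow> J' \<in> C \<Longrightarrow> J \<subseteq> J' \<or> J' \<subseteq> J"
  shows "homogeneous_ideal (\<Union>C)"
  unfolding homogeneous_ideal_def
proof (intro conjI ballI allI ideal_poly_ringI)
  note C_ideal = homogeneous_idealD(1)[OF C(2)]
  from C(1) obtain J where "J \<in> C" by blast
  then show "0 \<in> \<Union>C" by (intro UnionI[of J] ideal_zero[OF C_ideal])
  show "a + b \<in> \<Union>C" if ab: "a \<in> \<Union>C" "b \<in> \<Union>C" for a b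
  proof -
    from ab obtain J J' where J: "J \<in> C" "J' \<in> C" "a \<in> J" "b \<in> J'" by blast
    with chain[OF J(1,2)] obtain J'' where "J'' \<in> C" "a \<in> J''" "b \<in> J''" by blast
    then show ?thesis by (intro UnionI[of J''] ideal_add[OF C_ideal])
  qed
  show "r * a \<in> \<Union>C" if a: "a \<in> \<Union>C" for a r
  proof -
    from a obtain J where "J \<in> C" "a \<in> J" by (rule UnionE)
    then show ?thesis by (intro UnionI[of J] ideal_mult[OF C_ideal])
  qed
  show "hom_component d f \<in> \<Union>C" if f: "f \<in> \<Union>C" for f d
  proof -
    from f obtain J where "J \<in> C" "f \<in> J" by (rule UnionE)
    then show ?thesis by (intro UnionI[of J] homogeneous_idealD(2)[OF C(2)])
  qed
qed

text \<open>
  The usual source of primes: an ideal maximal among those without a property \<open>\<Gamma>\<close> is prime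
  if \<open>\<Gamma>\<close> passes from the two ideals obtained by adjoining the factors of a product in \<open>J\<close> down to
  \<open>J\<close>. The condition on chains says that unions of chains keep the defect, as the lemma of Zorn
  demands; it holds for properties that speak about finitely many elements of the ideal.
\<close>

lemma maximal_failing_ideal_prime:
  fixes I :: "('v, 'k::comm_ring_1) mpoly set"
  assumes I: "homogeneous_ideal I" "\<not> \<Gamma> I"
    and chain: "\<And>C. C \<noteq> {} \<Longrightarrow> (\<And>J. J \<in> C \<Longrightarrow> homogeneous_ideal J) \<Longrightarrow>
      (\<And>J J'. J \<in> C \<Longrightarrow> J' \<in> C \<Longrightarrow> J \<subseteq> J' \<or> J' \<subseteq> J) \<Longrightarrow> \<Gamma> (\<Union>C) \<Longrightarrow> \<exists>J\<in>C. \<Gamma> J"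
    and prod: "\<And>J f g a b. homogeneous_ideal J \<Longrightarrow> f \<in> forms a \<Longrightarrow> g \<in> forms b \<Longrightarrow> f * g \<in> J \<Longrightarrow>
      \<Gamma> (adjoin J f) \<Longrightarrow> \<Gamma> (adjoin J g) \<Longrightarrow> \<Gamma> J"
    and top: "\<And>J. homogeneous_ideal J \<Longrightarrow> 1 \<in> J \<Longrightarrow> \<Gamma> J"
  shows "\<exists>P. primeideal P poly_ring \<and> homogeneous_ideal P \<and> I \<subseteq> P \<and> \<not> \<Gamma> P"
proof -
  let ?A = "{J. homogeneous_ideal J \<and> I \<subseteq> J \<and> \<not> \<Gamma> J}"
  have "\<exists>P\<in>?A. \<forall>X\<in>?A. P \<subseteq> X \<longrightarrow> X = P"
  proof (rule subset_Zorn_nonempty)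
    show "?A \<noteq> {}" using I by blast
  next
    fix C assume C: "C \<noteq> {}" "subset.chain ?A C"
    then have sub: "C \<subseteq> ?A" and ch: "\<And>J J'. J \<in> C \<Longrightarrow> J' \<in> C \<Longrightarrow> J \<subseteq> J' \<or> J' \<subseteq> J"
      by (auto simp: subset_chain_def)
    have "homogeneous_ideal (\<Union>C)"
      by (rule homogeneous_ideal_Union_chain[OF C(1) _ ch]) (use sub in blast)+
    moreover have "\<not> \<Gamma> (\<Union>C)"
      using chain[OF C(1) _ ch] sub by blast
    ultimately show "\<Union>C \<in> ?A" using C(1) sub by blast
  qed
  then obtain P where "P \<in> ?A" and max: "\<forall>X\<in>?A. P \<subseteq> X \<longrightarrow> X = P" by (elim bexE)
  then have P: "homogeneous_ideal P" "I \<subseteq> P" "\<not> \<Gamma> P" by simp_all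
  note Pid = homogeneous_idealD(1)[OF P(1)]
  have max': "\<Gamma> Q" if "homogeneous_ideal Q" "P \<subset> Q" for Q
    using max[rule_format, of Q] that P(2) by auto
  have "primeideal P poly_ring"
  proof (rule primeideal_if_prime_on_forms[OF P(1)])
    show "1 \<notin> P" using top[OF P(1)] P(3) by blast
  next
    fix f g :: "('v, 'k) mpoly" and a b
    assume fg: "f \<in> forms a" "g \<in> forms b" "f * g \<in> P"
    show "f \<in> P \<or> g \<in> P"
    proof (rule ccontr)
      assume n: "\<not> (f \<in> P \<or> g \<in> P)"
      have "\<Gamma> (adjoin P f)"
        by (rule max'[OF homogeneous_ideal_adjoin[OF P(1) fg(1)]])
           (use n mem_adjoin[OF Pid, of f] subset_adjoin[of P f] in blast)
      moreover have "\<Gamma> (adjoin P g)"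
        by (rule max'[OF homogeneous_ideal_adjoin[OF P(1) fg(2)]])
           (use n mem_adjoin[OF Pid, of g] subset_adjoin[of P g] in blast)
      ultimately show False using prod[OF P(1) fg] P(3) by blast
    qed
  qed
  with P show ?thesis by blast
qed

text \<open>
  There are finitely many monomials of degree \<open>n\<close>, so one member of the chain accounts for all of
  them.
\<close>

lemma forms_subset_adjoin_Union_chain:
  fixes C :: "('v::finite, 'k::comm_ring_1) mpoly set set"
  assumes C: "C \<noteq> {}" "\<And>J. J \<in> C \<Longrightarrow> homogeneous_ideal J"
    and chain: "\<And>J J'. J \<in> C \<Longrightarrow> J' \<in> C \<Longrightarrow> J \<subseteq> J' \<or> J' \<subseteq> J"
    and sub: "forms n \<subseteq> adjoin (\<Union>C) L"
  shows "\<exists>J\<in>C. forms n \<subseteq> adjoin J L"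
proof -
  have "\<exists>J\<in>C. \<forall>m\<in>A. Mon m \<in> adjoin J L" if "finite A" "A \<subseteq> monoms_of_deg n" for A
    using that
  proof (induction A)
    case empty
    then show ?case using C(1) by auto
  next
    case (insert m A)
    then obtain J where J: "J \<in> C" "\<forall>m\<in>A. Mon m \<in> adjoin J L" by blast
    have "Mon m \<in> forms n" using insert.prems by (auto simp: monoms_of_deg_def intro: single_in_forms)
    with sub have "Mon m \<in> adjoin (\<Union>C) L" by blast
    then obtain a r where "a \<in> \<Union>C" "Mon m = a + r * L" by (rule adjoinE)
    then obtain J' where J': "J' \<in> C" "Mon m \<in> adjoin J' L" by (auto intro: adjoinI)
    show ?case
    proof (cases "J \<subseteq> J'")
      case True
      with J J' adjoin_mono[OF True, of L] show ?thesis by (intro bexI[of _ J']) auto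
    next
      case False
      with chain[OF J(1) J'(1)] have "J' \<subseteq> J" by blast
      from J J' adjoin_mono[OF this, of L] show ?thesis by (intro bexI[of _ J]) auto
    qed
  qed
  from this[OF finite_monoms_of_deg] obtain J where J: "J \<in> C" "\<forall>m\<in>monoms_of_deg n. Mon m \<in> adjoin J L"
    by blast
  note id = ideal_adjoin[OF homogeneous_idealD(1)[OF C(2)[OF J(1)]], of L]
  have "f \<in> adjoin J L" if "f \<in> forms n" for f
    by (subst forms_eq_sum[OF that]) (intro ideal_sum[OF id] ideal_mult[OF id] J(2)[rule_format])
  with J(1) show ?thesis by blast
qed

lemma forms_subset_adjoin_mult:
  fixes J :: "('v, 'k::comm_ring_1) mpoly set"
  assumes J: "ideal J poly_ring" and fg: "f * g \<in> J"
    and sub: "forms a \<subseteq> adjoin (adjoin J f) L" "forms b \<subseteq> adjoin (adjoin J g) L"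
  shows "forms (a + b) \<subseteq> adjoin J L"
proof (rule forms_add_subset_ideal)
  note K = ideal_adjoin[OF J, of L]
  show "ideal (adjoin J L) poly_ring" by (fact K)
  fix u v :: "('v, 'k) mpoly" assume "u \<in> forms a" "v \<in> forms b"
  then have "u \<in> adjoin (adjoin J f) L" "v \<in> adjoin (adjoin J g) L" using sub by auto
  then obtain i r s i' r' s' where u: "u = i + r * f + s * L" "i \<in> J" and v: "v = i' + r' * g + s' * L" "i' \<in> J"
    by (auto elim!: adjoinE)
  have "u * v = (i + s * L) * v + r * f * (i' + s' * L) + r * r' * (f * g)"
    unfolding u v by (simp add: algebra_simps)
  also have "\<dots> \<in> adjoin J L"
  proof (intro ideal_add[OF K])
    show "(i + s * L) * v \<in> adjoin J L" by (rule ideal_mult_right[OF K adjoinI[OF u(2) refl]])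
    show "r * f * (i' + s' * L) \<in> adjoin J L" by (rule ideal_mult[OF K adjoinI[OF v(2) refl]])
    show "r * r' * (f * g) \<in> adjoin J L" by (rule ideal_mult[OF K subsetD[OF subset_adjoin fg]])
  qed
  finally show "u * v \<in> adjoin J L" .
qed

lemma adjoin_zero: "adjoin J 0 = J"
  by (auto simp: adjoin_def)

text \<open>
  The projective form of the theorem that the radical is the intersection of the primes: a
  maximal ideal over \<open>I\<close> containing no power of the irrelevant ideal would be a point.
\<close>

lemma forms_subset_if_no_proj_points:
  fixes I :: "('v::finite, 'k::comm_ring_1) mpoly set"
  assumes I: "homogeneous_ideal I" and none: "proj_points I = {}"
  shows "\<exists>n. forms n \<subseteq> I"
proof (rule ccontr)
  assume bad: "\<nexists>n. forms n \<subseteq> I"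
  have "\<exists>P. primeideal P poly_ring \<and> homogeneous_ideal P \<and> I \<subseteq> P \<and> (\<nexists>n. forms n \<subseteq> P)"
  proof (rule maximal_failing_ideal_prime[where \<Gamma> = "\<lambda>J. \<exists>n. forms n \<subseteq> J", OF I bad])
    fix C :: "('v, 'k) mpoly set set"
    assume C: "C \<noteq> {}" "\<And>J. J \<in> C \<Longrightarrow> homogeneous_ideal J"
      "\<And>J J'. J \<in> C \<Longrightarrow> J' \<in> C \<Longrightarrow> J \<subseteq> J' \<or> J' \<subseteq> J" "\<exists>n. forms n \<subseteq> \<Union>C"
    then obtain n where "forms n \<subseteq> \<Union>C" by blast
    then have "\<exists>J\<in>C. forms n \<subseteq> adjoin J 0"
      by (intro forms_subset_adjoin_Union_chain[OF C(1,2,3)]) (simp_all add: adjoin_zero)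
    then show "\<exists>J\<in>C. \<exists>n. forms n \<subseteq> J" by (auto simp: adjoin_zero)
  next
    fix J :: "('v, 'k) mpoly set" and f g a b
    assume J: "homogeneous_ideal J" "f * g \<in> J" "\<exists>n. forms n \<subseteq> adjoin J f" "\<exists>n. forms n \<subseteq> adjoin J g"
    then obtain n n' where "forms n \<subseteq> adjoin J f" "forms n' \<subseteq> adjoin J g" by blast
    then have "forms (n + n') \<subseteq> adjoin J 0"
      by (intro forms_subset_adjoin_mult[OF homogeneous_idealD(1)[OF J(1)] J(2)]) (simp_all add: adjoin_zero)
    then show "\<exists>n. forms n \<subseteq> J" by (auto simp: adjoin_zero)
  next
    fix J :: "('v, 'k) mpoly set"
    assume J: "homogeneous_ideal J" "1 \<in> J"
    then show "\<exists>n. forms n \<subseteq> J"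
      using ideal_mult[OF homogeneous_idealD(1)[OF J(1)] J(2)] by (intro exI[of _ 0]) auto
  qed
  then obtain P where P: "primeideal P poly_ring" "homogeneous_ideal P" "I \<subseteq> P" "\<nexists>n. forms n \<subseteq> P"
    by blast
  have "forms 1 \<subseteq> (irrelevant_ideal :: ('v, 'k) mpoly set)"
    by (auto simp: irrelevant_ideal_def forms_iff_lookup)
  with P have "P \<in> proj_points I" by (auto simp: proj_points_def)
  with none show False by blast
qed

lemma no_chain_of_proj_points:
  assumes "proj_dim I = 0" "P \<in> proj_points I" "Q \<in> proj_points I"
  shows "\<not> P \<subset> Q"
proof
  assume PQ: "P \<subset> Q"
  have "enat 1 \<le> proj_dim I"
    unfolding proj_dim_def
    by (rule Sup_upper, intro CollectI exI[of _ 1] conjI exI[of _ "\<lambda>i::nat. if i = 0 then P else Q"])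
       (use assms PQ in auto)
  with assms(1) show False by (simp add: zero_enat_def)
qed

lemma exhaust_three: "v = 0 \<or> v = 1 \<or> v = 2" for v :: 3
proof (induct v)
  case (of_int z)
  then have "z = 0 \<or> z = 1 \<or> z = 2" by fastforce
  then show ?case by auto
qed

text \<open>
  Three different members of this family are linearly independent, and its coefficients depend
  polynomially on one parameter; so it can replace the general linear form.
\<close>

definition moment_form :: "'k \<Rightarrow> (3, 'k::comm_ring_1) mpoly" where
  "moment_form s = Var 0 + Const s * Var 1 + Const (s\<^sup>2) * Var 2"

lemma Var_in_forms [simp]: "Var v \<in> forms 1"
  by (rule single_in_forms) simp

lemma moment_form_in_forms [simp]: "moment_form s \<in> forms 1"
  unfolding moment_form_def by (intro forms_add forms_Const_mult Var_in_forms)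

lemma finite_zeros_moment_form:
  fixes p :: "(3 \<Rightarrow>\<^sub>0 nat, 'k::field) mpoly"
  assumes "eval_mpoly p (Poly_Mapping.lookup (moment_form s0)) \<noteq> 0"
  shows "finite {s. eval_mpoly p (Poly_Mapping.lookup (moment_form s)) = 0}"
  using _ assms
proof (rule finite_zeros_on_curve)
  fix m :: "3 \<Rightarrow>\<^sub>0 nat"
  show "\<exists>q. \<forall>s::'k. Poly_Mapping.lookup (moment_form s) m = poly q s"
    by (rule exI[of _ "[:Poly_Mapping.lookup (Var 0) m, Poly_Mapping.lookup (Var 1) m,
        Poly_Mapping.lookup (Var 2) m:]"])
       (simp add: moment_form_def lookup_add power2_eq_square algebra_simps)
qed

lemma linear_forms_subset_ideal:
  fixes K :: "(3, 'k::comm_ring_1) mpoly set"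
  assumes K: "ideal K poly_ring" and "Var 0 \<in> K" "Var 1 \<in> K" "Var 2 \<in> K"
  shows "forms 1 \<subseteq> K"
proof
  fix f :: "(3, 'k) mpoly" assume "f \<in> forms 1"
  then show "f \<in> K"
  proof (induction rule: forms_induct)
    case (single m c)
    then have "monom_deg m = Suc 0" by simp
    then obtain v m' where "m = Poly_Mapping.single v (Suc 0) + m'" "monom_deg m' = 0"
      by (rule monom_deg_Suc_split)
    then have "Poly_Mapping.single m c = Const c * Var v"
      by (simp add: monom_deg_eq_0_iff mult_single)
    moreover have "Var v \<in> K" using exhaust_three[of v] assms(2-4) by auto
    ultimately show ?case by (simp only: ideal_mult[OF K])
  qed (auto intro: ideal_zero[OF K] ideal_add[OF K])
qed

lemma ex_moment_form_notin:
  fixes K :: "(3, 'k::field) mpoly set"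
  assumes inf: "infinite (UNIV :: 'k set)" and K: "ideal K poly_ring" and n: "\<not> forms 1 \<subseteq> K"
  shows "\<exists>s. moment_form s \<notin> K"
proof (rule ccontr)
  assume "\<nexists>s. moment_form s \<notin> K"
  then have all: "moment_form s \<in> K" for s by blast
  obtain t :: 'k where t: "t \<notin> {0, 1}" using ex_new_if_finite[OF inf, of "{0, 1}"] by auto
  have cancel: "f \<in> K" if "Const c * f \<in> K" "c \<noteq> 0" for c f
    using ideal_mult[OF K that(1), of "Const (inverse c)"] that(2)
    by (simp add: mult_single flip: mult.assoc)
  have slope: "Var 1 + Const s * Var 2 \<in> K" if "s \<noteq> 0" for s
  proof (rule cancel[OF _ that])
    have "moment_form s - moment_form 0 = Const s * (Var 1 + Const s * Var 2)"
      by (simp add: moment_form_def distrib_left mult_single power2_eq_square)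
    then show "Const s * (Var 1 + Const s * Var 2) \<in> K" using ideal_diff[OF K all all] by metis
  qed
  have v2: "Var 2 \<in> K"
  proof (rule cancel)
    have "Const (t - 1) * Var 2 = (Var 1 + Const t * Var 2) - (Var 1 + Const 1 * Var 2 :: (3, 'k) mpoly)"
      by (simp add: single_diff left_diff_distrib)
    then show "Const (t - 1) * Var 2 \<in> K" using ideal_diff[OF K slope slope, of t 1] t by simp
  qed (use t in auto)
  have v1: "Var 1 \<in> K" using ideal_diff[OF K slope[of 1] ideal_mult[OF K v2, of "Const 1"]] by simp
  have "Var 0 \<in> K" using all[of 0] by (simp add: moment_form_def)
  with linear_forms_subset_ideal[OF K _ v1 v2] n show False by blast
qed

text \<open>
  Suppose that no linear form of the family cuts \<open>I\<close> down to finite colength. A maximal ideal \<open>P\<close>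
  over \<open>I\<close> with this defect is prime: by openness, two forms of the family that work after adjoining
  \<open>f\<close> and after adjoining \<open>g\<close> can be replaced by a common one, which then works for \<open>P\<close> if
  \<open>f * g \<in> P\<close>. So \<open>P\<close> is a point of the scheme. A form of the family outside \<open>P\<close> lies in no point
  over \<open>P\<close>, since in dimension zero there is no point strictly above \<open>P\<close>; hence it does cut \<open>P\<close>
  down.
\<close>

lemma ex_moment_form_finite_colength:
  fixes I :: "(3, 'k::field) mpoly set"
  assumes inf: "infinite (UNIV :: 'k set)" and I: "homogeneous_ideal I" and dim: "proj_dim I = 0"
  shows "\<exists>s n. forms n \<subseteq> adjoin I (moment_form s)"
proof (rule ccontr)
  assume bad: "\<nexists>s n. forms n \<subseteq> adjoin I (moment_form s)"
  have "\<exists>P. primeideal P poly_ring \<and> homogeneous_ideal P \<and> I \<subseteq> P \<and>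
    (\<nexists>s n. forms n \<subseteq> adjoin P (moment_form s))"
  proof (rule maximal_failing_ideal_prime[where \<Gamma> = "\<lambda>J. \<exists>s n. forms n \<subseteq> adjoin J (moment_form s)", OF I bad])
    fix C :: "(3, 'k) mpoly set set"
    assume C: "C \<noteq> {}" "\<And>J. J \<in> C \<Longrightarrow> homogeneous_ideal J"
      "\<And>J J'. J \<in> C \<Longrightarrow> J' \<in> C \<Longrightarrow> J \<subseteq> J' \<or> J' \<subseteq> J" "\<exists>s n. forms n \<subseteq> adjoin (\<Union>C) (moment_form s)"
    from C(4) obtain s n where "forms n \<subseteq> adjoin (\<Union>C) (moment_form s)" by blast
    from forms_subset_adjoin_Union_chain[OF C(1,2,3) this]
    show "\<exists>J\<in>C. \<exists>s n. forms n \<subseteq> adjoin J (moment_form s)" by blast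
  next
    fix J :: "(3, 'k) mpoly set" and f g a b
    assume J: "homogeneous_ideal J" and fg: "f \<in> forms a" "g \<in> forms b" "f * g \<in> J"
      and "\<exists>s n. forms n \<subseteq> adjoin (adjoin J f) (moment_form s)"
        "\<exists>s n. forms n \<subseteq> adjoin (adjoin J g) (moment_form s)"
    then obtain s n s' n' where sub: "forms n \<subseteq> adjoin (adjoin J f) (moment_form s)"
      "forms n' \<subseteq> adjoin (adjoin J g) (moment_form s')" by blast
    obtain p where p: "eval_mpoly p (Poly_Mapping.lookup (moment_form s)) \<noteq> 0"
      "\<forall>G\<in>forms 1. eval_mpoly p (Poly_Mapping.lookup G) \<noteq> 0 \<longrightarrow> forms n \<subseteq> adjoin (adjoin J f) G"
      using zariski_near_forms_subset_adjoin[OF homogeneous_ideal_adjoin[OF J fg(1)] moment_form_in_forms sub(1)]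
      unfolding zariski_near_def by (elim exE conjE)
    obtain q where q: "eval_mpoly q (Poly_Mapping.lookup (moment_form s')) \<noteq> 0"
      "\<forall>G\<in>forms 1. eval_mpoly q (Poly_Mapping.lookup G) \<noteq> 0 \<longrightarrow> forms n' \<subseteq> adjoin (adjoin J g) G"
      using zariski_near_forms_subset_adjoin[OF homogeneous_ideal_adjoin[OF J fg(2)] moment_form_in_forms sub(2)]
      unfolding zariski_near_def by (elim exE conjE)
    have "finite ({t. eval_mpoly p (Poly_Mapping.lookup (moment_form t)) = 0}
        \<union> {t. eval_mpoly q (Poly_Mapping.lookup (moment_form t)) = 0})"
      using finite_zeros_moment_form[OF p(1)] finite_zeros_moment_form[OF q(1)] by blast
    with inf obtain t where "t \<notin> {t. eval_mpoly p (Poly_Mapping.lookup (moment_form t)) = 0}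
        \<union> {t. eval_mpoly q (Poly_Mapping.lookup (moment_form t)) = 0}"
      using ex_new_if_finite by blast
    then have "forms (n + n') \<subseteq> adjoin J (moment_form t)"
      by (intro forms_subset_adjoin_mult[OF homogeneous_idealD(1)[OF J] fg(3)] moment_form_in_forms p(2)[rule_format] q(2)[rule_format]) auto
    then show "\<exists>s n. forms n \<subseteq> adjoin J (moment_form s)" by blast
  next
    fix J :: "(3, 'k) mpoly set"
    assume J: "homogeneous_ideal J" "1 \<in> J"
    then have "f \<in> J" for f
      using ideal_mult[OF homogeneous_idealD(1)[OF J(1)] J(2), of f] by simp
    then have "forms 0 \<subseteq> adjoin J (moment_form 0)"
      using subset_adjoin[of J "moment_form 0"] by auto
    then show "\<exists>s n. forms n \<subseteq> adjoin J (moment_form s)" by blast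
  qed
  then obtain P where P: "primeideal P poly_ring" "homogeneous_ideal P" "I \<subseteq> P"
    "\<nexists>s n. forms n \<subseteq> adjoin P (moment_form s)" by blast
  note Pid = homogeneous_idealD(1)[OF P(2)]
  have n1: "\<not> forms 1 \<subseteq> P"
  proof
    assume "forms 1 \<subseteq> P"
    then have "forms 1 \<subseteq> adjoin P (moment_form 0)" by (rule subset_trans[OF _ subset_adjoin])
    with P(4) show False by blast
  qed
  moreover have "forms 1 \<subseteq> (irrelevant_ideal :: (3, 'k) mpoly set)"
    by (auto simp: irrelevant_ideal_def forms_iff_lookup)
  ultimately have PI: "P \<in> proj_points I" using P by (auto simp: proj_points_def)
  obtain s where s: "moment_form s \<notin> P" using ex_moment_form_notin[OF inf Pid n1] by blast
  have "proj_points (adjoin P (moment_form s)) = {}"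
  proof (rule ccontr)
    assume "\<not> ?thesis"
    then obtain Q where Q: "Q \<in> proj_points (adjoin P (moment_form s))" by blast
    then have "adjoin P (moment_form s) \<subseteq> Q" by (simp add: proj_points_def)
    then have "P \<subset> Q" using s mem_adjoin[OF Pid] subset_adjoin[of P] by blast
    moreover have "Q \<in> proj_points I"
      using Q P(3) \<open>P \<subset> Q\<close> by (auto simp: proj_points_def)
    ultimately show False using no_chain_of_proj_points[OF dim PI] by blast
  qed
  then have "\<exists>n. forms n \<subseteq> adjoin P (moment_form s)"
    by (rule forms_subset_if_no_proj_points[OF homogeneous_ideal_adjoin[OF P(2) moment_form_in_forms]])
  with P(4) show False by blast
qed

text \<open>
  If \<open>L f \<in> I\<close> then all of \<open>I + (L)\<close>, and so a power of the irrelevant ideal, multiplies \<open>f\<close> into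
  \<open>I\<close>; for a saturated \<open>I\<close> this forces \<open>f \<in> I\<close>.
\<close>

lemma nonzerodivisor_if_finite_colength:
  fixes I :: "('v, 'k::comm_ring_1) mpoly set"
  assumes I: "ideal I poly_ring" "saturation I = I" and sub: "forms n \<subseteq> adjoin I L" and Lf: "L * f \<in> I"
  shows "f \<in> I"
proof -
  have "g * f \<in> I" if "g \<in> forms n" for g
  proof -
    from that sub have "g \<in> adjoin I L" by blast
    then obtain a r where g: "a \<in> I" "g = a + r * L" by (rule adjoinE)
    have "g * f = a * f + r * (L * f)" by (simp add: g algebra_simps)
    also have "\<dots> \<in> I" by (intro ideal_add[OF I(1)] ideal_mult_right[OF I(1) g(1)] ideal_mult[OF I(1) Lf])
    finally show ?thesis .
  qed
  then have "f \<in> saturation I" by (auto simp: saturation_def)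
  with I(2) show ?thesis by simp
qed

section \<open>Products of linear forms of maximal rank\<close>

text \<open>A parametrization of the line \<open>moment_form s = 0\<close>, without its point at infinity.\<close>

definition line_point :: "'k \<Rightarrow> 'k \<Rightarrow> 3 \<Rightarrow> 'k::comm_ring_1" where
  "line_point s t v = (if v = 0 then - (s * t + s\<^sup>2) else if v = 1 then t else 1)"

lemma line_point_simps [simp]:
  "line_point s t 0 = - (s * t + s\<^sup>2)" "line_point s t 1 = t" "line_point s t 2 = 1"
  by (simp_all add: line_point_def)

text \<open>Together with \<open>moment_form s\<close> this linear form cuts out \<open>line_point s t\<close>, for every \<open>s\<close>.\<close>

definition through_point :: "'k \<Rightarrow> (3, 'k::comm_ring_1) mpoly" where
  "through_point t = Var 1 - Const t * Var 2"

lemma through_point_in_forms [simp]: "through_point t \<in> forms 1"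
  unfolding through_point_def by (intro forms_diff forms_Const_mult Var_in_forms)

lemma eval_through_point [simp]: "eval_mpoly (through_point t) (line_point s t') = t' - t"
  by (simp add: through_point_def)

lemma eval_moment_form [simp]: "eval_mpoly (moment_form s) (line_point s t) = 0"
  by (simp add: moment_form_def)

abbreviation line_ideal :: "'k \<Rightarrow> (3, 'k::comm_ring_1) mpoly set" where
  "line_ideal s \<equiv> adjoin {0} (moment_form s)"

lemma ideal_zero_set: "ideal {0} (poly_ring :: ('v, 'k::comm_ring_1) mpoly ring)"
  by (rule ideal_poly_ringI) auto

lemma homogeneous_line_ideal: "homogeneous_ideal (line_ideal s)"
  by (rule homogeneous_ideal_adjoin[OF _ moment_form_in_forms])
     (auto simp: homogeneous_ideal_def ideal_zero_set)

lemma ideal_line_ideal: "ideal (line_ideal s) poly_ring"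
  by (rule homogeneous_idealD(1)[OF homogeneous_line_ideal])

lemma line_ideal_subset:
  assumes "ideal I poly_ring" shows "line_ideal s \<subseteq> adjoin I (moment_form s)"
  by (rule adjoin_mono) (use ideal_zero[OF assms] in auto)

lemma eval_line_ideal: "f \<in> line_ideal s \<Longrightarrow> eval_mpoly f (line_point s t) = 0"
  by (auto elim!: adjoinE)

text \<open>
  Modulo the two linear forms that cut out a point of the line, every variable is a multiple of
  the last one, which takes the value \<open>1\<close> at the point.
\<close>

lemma form_congruent_value:
  fixes f :: "(3, 'k::comm_ring_1) mpoly"
  assumes "f \<in> forms n"
  shows "f - Const (eval_mpoly f (line_point s t)) * Var 2 ^ n \<in> adjoin (line_ideal s) (through_point t)"
    (is "_ \<in> ?K")
proof -
  have K: "ideal ?K poly_ring" by (rule ideal_adjoin[OF ideal_line_ideal])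
  have through: "through_point t \<in> ?K" by (rule mem_adjoin[OF ideal_line_ideal])
  have line: "moment_form s \<in> ?K"
    by (rule subsetD[OF subset_adjoin mem_adjoin[OF ideal_zero_set]])
  have Var: "Var v - Const (line_point s t v) * Var 2 \<in> ?K" for v :: 3
  proof -
    consider "v = 0" | "v = 1" | "v = 2" using exhaust_three[of v] by blast
    then show ?thesis
    proof cases
      case 1
      have "Var v - Const (line_point s t v) * Var 2 = moment_form s - Const s * through_point t"
        by (simp add: 1 moment_form_def through_point_def single_add single_diff single_uminus mult_single algebra_simps)
      then show ?thesis using ideal_diff[OF K line ideal_mult[OF K through]] by simp
    next
      case 2
      then show ?thesis using through by (simp add: through_point_def)
    next
      case 3
      then show ?thesis using ideal_zero[OF K] by simp
    qed
  qed
  show ?thesis using assms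
  proof (induction rule: forms_induct)
    case zero
    then show ?case using ideal_zero[OF K] by simp
  next
    case (add f g)
    have eq: "f + g - Const (eval_mpoly (f + g) (line_point s t)) * Var 2 ^ n
        = (f - Const (eval_mpoly f (line_point s t)) * Var 2 ^ n)
          + (g - Const (eval_mpoly g (line_point s t)) * Var 2 ^ n)"
      by (simp add: single_add algebra_simps)
    show ?case unfolding eq by (rule ideal_add[OF K add])
  next
    case (single m c)
    then show ?case
    proof (induction n arbitrary: m)
      case 0
      then show ?case using ideal_zero[OF K] by (simp add: monom_deg_eq_0_iff)
    next
      case (Suc n)
      then obtain v m' where m: "m = Poly_Mapping.single v (Suc 0) + m'" "monom_deg m' = n"
        by (auto elim: monom_deg_Suc_split)
      let ?g = "Poly_Mapping.single m' c :: (3, 'k) mpoly"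
      let ?e = "eval_mpoly ?g (line_point s t)"
      have single: "Poly_Mapping.single m c = Var v * ?g" by (simp add: m mult_single)
      have eval_eq: "Const (eval_mpoly (Poly_Mapping.single m c) (line_point s t)) = Const ?e * Const (line_point s t v)"
        unfolding single eval_mpoly_mult eval_mpoly_Var by (simp add: mult_single mult.commute)
      have "Poly_Mapping.single m c - Const (eval_mpoly (Poly_Mapping.single m c) (line_point s t)) * Var 2 ^ Suc n
          = Var v * (?g - Const ?e * Var 2 ^ n)
            + Const ?e * Var 2 ^ n * (Var v - Const (line_point s t v) * Var 2)"
        unfolding eval_eq unfolding single power_Suc by (simp only: algebra_simps)
      also have "\<dots> \<in> ?K"
        by (intro ideal_add[OF K] ideal_mult[OF K] Suc.IH m(2) Var)
      finally show ?case .
    qed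
  qed
qed

lemma through_points_in_forms:
  "finite T \<Longrightarrow> (\<Prod>t\<in>T. through_point t :: (3, 'k::comm_ring_1) mpoly) \<in> forms (card T)"
proof (induction T rule: finite_induct)
  case (insert t T)
  then show ?case using forms_mult[OF through_point_in_forms insert.IH, of t] by simp
qed simp

lemma eval_through_points:
  "eval_mpoly (\<Prod>t\<in>T. through_point t) (line_point s t') = (\<Prod>t\<in>T. t' - t)"
  by (induction T rule: infinite_finite_induct) simp_all

text \<open>
  A form vanishing at \<open>line_point s t\<close> is, on the line, a multiple of \<open>through_point t\<close>, and the
  cofactor, of degree one less, still vanishes at the other points.
\<close>

lemma form_vanishing_at_points:
  fixes g :: "(3, 'k::field) mpoly"
  assumes "finite T" "g \<in> forms n" "\<And>t. t \<in> T \<Longrightarrow> eval_mpoly g (line_point s t) = 0"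
  shows "g \<in> adjoin (line_ideal s) (\<Prod>t\<in>T. through_point t) \<and> (n < card T \<longrightarrow> g \<in> line_ideal s)"
  using assms
proof (induction T arbitrary: g n rule: finite_induct)
  case empty
  then show ?case by (auto intro!: adjoinI[of 0 _ _ g] ideal_zero[OF ideal_line_ideal])
next
  case (insert t T)
  note K = ideal_line_ideal[of s]
  let ?P = "\<Prod>t\<in>T. through_point t :: (3, 'k) mpoly"
  have "g \<in> adjoin (line_ideal s) (through_point t)"
    using form_congruent_value[OF insert.prems(1), of s t] insert.prems(2)[of t] by simp
  then obtain a r where g: "a \<in> line_ideal s" "a \<in> forms n" "r \<in> forms (n - 1)"
      "g = a + r * through_point t" "n < 1 \<longrightarrow> r = 0"
    by (rule form_in_adjoinE[OF homogeneous_line_ideal through_point_in_forms _ insert.prems(1)])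
  have "eval_mpoly r (line_point s t') = 0" if "t' \<in> T" for t'
    using insert.prems(2)[of t'] that insert.hyps(2) by (auto simp: g(4) eval_line_ideal[OF g(1)])
  from insert.IH[OF g(3) this]
  have r: "r \<in> adjoin (line_ideal s) ?P" "n - 1 < card T \<Longrightarrow> r \<in> line_ideal s" by auto
  from r(1) obtain b u where bu: "b \<in> line_ideal s" "r = b + u * ?P" by (rule adjoinE)
  have "g = (a + b * through_point t) + u * (\<Prod>t\<in>insert t T. through_point t)"
    using insert.hyps by (simp add: g(4) bu(2) algebra_simps)
  moreover have "a + b * through_point t \<in> line_ideal s"
    by (intro ideal_add[OF K] ideal_mult_right[OF K] g(1) bu(1))
  ultimately have "g \<in> adjoin (line_ideal s) (\<Prod>t\<in>insert t T. through_point t)" by (auto intro: adjoinI)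
  moreover have "g \<in> line_ideal s" if "n < card (insert t T)"
  proof (cases "n < 1")
    case True
    with g show ?thesis by simp
  next
    case False
    with that insert.hyps have "r \<in> line_ideal s" by (intro r(2)) auto
    from ideal_add[OF K g(1) ideal_mult_right[OF K this]] show ?thesis by (simp only: g(4))
  qed
  ultimately show ?case by (intro conjI impI)
qed

lemma finite_zeros_on_line:
  fixes g :: "(3, 'k::field) mpoly"
  assumes "g \<in> forms n" "g \<notin> line_ideal s"
  shows "finite {t. eval_mpoly g (line_point s t) = 0}"
proof (rule ccontr)
  assume "infinite {t. eval_mpoly g (line_point s t) = 0}"
  then obtain T where T: "T \<subseteq> {t. eval_mpoly g (line_point s t) = 0}" "finite T" "card T = Suc n"
    using infinite_arbitrarily_large by blast
  with form_vanishing_at_points[OF T(2) assms(1), of s] assms(2) show False by auto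
qed

text \<open>
  A general point imposes a condition on every linear space of forms on the line that is not yet
  zero. Hence \<open>d\<close> points can be chosen so that, for each of finitely many such spaces, either no
  nonzero member vanishes at all of them, or the values at them can be prescribed.
\<close>

lemma ex_points_in_general_position:
  fixes V :: "nat \<Rightarrow> (3, 'k::field) mpoly set"
  assumes inf: "infinite (UNIV :: 'k set)"
    and V: "\<And>n. V n \<subseteq> forms (e n)" "\<And>n. 0 \<in> V n" "\<And>n f g. f \<in> V n \<Longrightarrow> g \<in> V n \<Longrightarrow> f + g \<in> V n"
      "\<And>n c f. f \<in> V n \<Longrightarrow> Const c * f \<in> V n"
  shows "\<exists>T. finite T \<and> card T = d \<and> (\<forall>n<N.
    (\<forall>v\<in>V n. (\<forall>t\<in>T. eval_mpoly v (line_point s t) = 0) \<longrightarrow> v \<in> line_ideal s) \<or>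
    (\<forall>c. \<exists>v\<in>V n. \<forall>t\<in>T. eval_mpoly v (line_point s t) = c t))"
    (is "\<exists>T. finite T \<and> card T = d \<and> (\<forall>n<N. ?inj T n \<or> ?surj T n)")
proof (induction d)
  case 0
  show ?case by (rule exI[of _ "{}"]) (use V(2) in auto)
next
  case (Suc d)
  then obtain T where T: "finite T" "card T = d" "\<And>n. n < N \<Longrightarrow> ?inj T n \<or> ?surj T n" by blast
  have "\<exists>B. finite B \<and> (\<forall>t. t \<notin> B \<longrightarrow> t \<notin> T \<longrightarrow> ?inj (insert t T) n \<or> ?surj (insert t T) n)"
    if n: "n < N" for n
  proof (cases "?inj T n")
    case True
    then have "?inj (insert t T) n" for t by blast
    then show ?thesis by (intro exI[of _ "{}"]) auto
  next
    case False
    then obtain u where u: "u \<in> V n" "\<And>t. t \<in> T \<Longrightarrow> eval_mpoly u (line_point s t) = 0" "u \<notin> line_ideal s"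
      by blast
    from False T(3)[OF n] have surj: "?surj T n" by blast
    let ?B = "{t. eval_mpoly u (line_point s t) = 0}"
    have "?surj (insert t T) n" if t: "t \<notin> ?B" "t \<notin> T" for t
    proof
      fix c
      obtain v where v: "v \<in> V n" "\<And>t. t \<in> T \<Longrightarrow> eval_mpoly v (line_point s t) = c t"
        using surj by blast
      \<comment> \<open>correct the value at the new point by \<open>u\<close>, which vanishes at the old ones\<close>
      define w where "w = v + Const ((c t - eval_mpoly v (line_point s t)) / eval_mpoly u (line_point s t)) * u"
      have "w \<in> V n" unfolding w_def by (intro V(3,4) v u)
      moreover have "\<forall>t'\<in>insert t T. eval_mpoly w (line_point s t') = c t'"
        using v(2) u(2) t by (auto simp: w_def)
      ultimately show "\<exists>v\<in>V n. \<forall>t'\<in>insert t T. eval_mpoly v (line_point s t') = c t'" by blast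
    qed
    moreover have "finite ?B" using finite_zeros_on_line[OF _ u(3)] V(1) u(1) by blast
    ultimately show ?thesis by (intro exI[of _ ?B]) blast
  qed
  then obtain B where B: "\<And>n. n < N \<Longrightarrow> finite (B n)"
    "\<And>n t. n < N \<Longrightarrow> t \<notin> B n \<Longrightarrow> t \<notin> T \<Longrightarrow> ?inj (insert t T) n \<or> ?surj (insert t T) n"
    by metis
  have "finite ((\<Union>n<N. B n) \<union> T)" using B(1) T(1) by auto
  then obtain t where t: "t \<notin> (\<Union>n<N. B n) \<union> T" using ex_new_if_finite[OF inf] by blast
  show ?case
  proof (intro exI[of _ "insert t T"] conjI allI impI)
    show "finite (insert t T)" "card (insert t T) = Suc d" using t T by auto
    fix n assume "n < N"
    then show "?inj (insert t T) n \<or> ?surj (insert t T) n" using B(2)[of n t] t by blast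
  qed
qed

text \<open>
  For a homogeneous ideal \<open>K\<close> and a form \<open>G\<close> of degree \<open>d\<close> this is maximal rank of the map given
  by \<open>G\<close> on the graded ring \<open>R/K\<close>, in degree \<open>n\<close>.
\<close>

definition max_rank :: "('v, 'k::comm_ring_1) mpoly set \<Rightarrow> nat \<Rightarrow> ('v, 'k) mpoly \<Rightarrow> nat \<Rightarrow> bool" where
  "max_rank K d G n \<longleftrightarrow> (\<forall>f\<in>forms n. G * f \<in> K \<longrightarrow> f \<in> K) \<or> forms (n + d) \<subseteq> adjoin K G"

lemma zariski_near_max_rank:
  fixes K :: "('v::finite, 'k::field) mpoly set"
  assumes K: "homogeneous_ideal K" "forms N \<subseteq> K" and G0: "G0 \<in> forms d" "\<And>n. max_rank K d G0 n"
  shows "zariski_near d G0 (\<lambda>G. \<forall>n. max_rank K d G n)"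
proof -
  have "zariski_near d G0 (\<lambda>G. max_rank K d G n)" for n
    using G0(2)[of n] unfolding max_rank_def
  proof
    assume "\<forall>f\<in>forms n. G0 * f \<in> K \<longrightarrow> f \<in> K"
    then have "zariski_near d G0 (\<lambda>G. \<forall>f\<in>forms n. G * f \<in> K \<longrightarrow> f \<in> K)"
      by (intro zariski_near_mult_injective homogeneous_idealD(1)[OF K(1)] G0(1)) blast
    then show "zariski_near d G0 (\<lambda>G. (\<forall>f\<in>forms n. G * f \<in> K \<longrightarrow> f \<in> K) \<or> forms (n + d) \<subseteq> adjoin K G)"
      by (rule zariski_near_mono) blast
  next
    assume "forms (n + d) \<subseteq> adjoin K G0"
    from zariski_near_forms_subset_adjoin[OF K(1) G0(1) this]
    show "zariski_near d G0 (\<lambda>G. (\<forall>f\<in>forms n. G * f \<in> K \<longrightarrow> f \<in> K) \<or> forms (n + d) \<subseteq> adjoin K G)"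
      by (rule zariski_near_mono) blast
  qed
  then have "zariski_near d G0 (\<lambda>G. \<forall>n\<in>{..<N}. max_rank K d G n)"
    by (intro zariski_near_ball) auto
  then show ?thesis
  proof (rule zariski_near_mono)
    fix G :: "('v, 'k) mpoly" assume G: "\<forall>n\<in>{..<N}. max_rank K d G n"
    show "\<forall>n. max_rank K d G n"
    proof
      fix n show "max_rank K d G n"
      proof (cases "n < N")
        case False
        then have "forms (n + d) \<subseteq> K"
          by (intro forms_subset_ideal_mono[OF homogeneous_idealD(1)[OF K(1)] K(2)]) auto
        then show ?thesis using subset_adjoin[of K G] unfolding max_rank_def by blast
      qed (use G in auto)
    qed
  qed
qed

text \<open>
  The form is the product of the linear forms through points in general position for the spaces
  \<open>I \<inter> forms (n + d)\<close>. The two alternatives for the points become injectivity and surjectivity.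
\<close>

lemma ex_form_max_rank:
  fixes I :: "(3, 'k::field) mpoly set"
  assumes inf: "infinite (UNIV :: 'k set)" and I: "homogeneous_ideal I"
    and N: "forms N \<subseteq> adjoin I (moment_form s)"
  shows "\<exists>F\<in>forms d. \<forall>n. max_rank (adjoin I (moment_form s)) d F n"
proof -
  let ?J = "adjoin I (moment_form s)"
  note Iid = homogeneous_idealD(1)[OF I]
  note Jid = ideal_adjoin[OF Iid, of "moment_form s"]
  have "\<exists>T. finite T \<and> card T = d \<and> (\<forall>n<N.
    (\<forall>v\<in>I \<inter> forms (n + d). (\<forall>t\<in>T. eval_mpoly v (line_point s t) = 0) \<longrightarrow> v \<in> line_ideal s) \<or>
    (\<forall>c. \<exists>v\<in>I \<inter> forms (n + d). \<forall>t\<in>T. eval_mpoly v (line_point s t) = c t))"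
    by (rule ex_points_in_general_position[OF inf])
       (auto intro: ideal_zero[OF Iid] ideal_add[OF Iid] ideal_mult[OF Iid] forms_add forms_Const_mult)
  then obtain T where T: "finite T" "card T = d" "\<And>n. n < N \<Longrightarrow>
    (\<forall>v\<in>I \<inter> forms (n + d). (\<forall>t\<in>T. eval_mpoly v (line_point s t) = 0) \<longrightarrow> v \<in> line_ideal s) \<or>
    (\<forall>c. \<exists>v\<in>I \<inter> forms (n + d). \<forall>t\<in>T. eval_mpoly v (line_point s t) = c t)"
    by auto
  define F :: "(3, 'k) mpoly" where "F = (\<Prod>t\<in>T. through_point t)"
  have F: "F \<in> forms d" using through_points_in_forms[OF T(1)] by (simp add: F_def T(2))
  have F_eval: "eval_mpoly F (line_point s t) = 0 \<longleftrightarrow> t \<in> T" for t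
    using T(1) by (auto simp: F_def eval_through_points prod_zero_iff)
  have "max_rank ?J d F n" for n
  proof (cases "n < N")
    case False
    then have "forms (n + d) \<subseteq> ?J" by (intro forms_subset_ideal_mono[OF Jid N]) auto
    then show ?thesis using subset_adjoin[of ?J F] unfolding max_rank_def by blast
  next
    case True
    from T(3)[OF this] show ?thesis
    proof
      assume inj: "\<forall>v\<in>I \<inter> forms (n + d). (\<forall>t\<in>T. eval_mpoly v (line_point s t) = 0) \<longrightarrow> v \<in> line_ideal s"
      have "f \<in> ?J" if f: "f \<in> forms n" "F * f \<in> ?J" for f
      proof -
        have "F * f \<in> forms (n + d)" using forms_mult[OF F f(1)] by (simp add: add.commute)
        with f(2) obtain a r where a: "a \<in> I" "a \<in> forms (n + d)" "F * f = a + r * moment_form s"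
          by (rule form_in_adjoinE[OF I moment_form_in_forms])
        have eq: "eval_mpoly a (line_point s t) = eval_mpoly F (line_point s t) * eval_mpoly f (line_point s t)" for t
        proof -
          have "eval_mpoly (F * f) (line_point s t) = eval_mpoly (a + r * moment_form s) (line_point s t)"
            by (simp only: a(3))
          then show ?thesis by simp
        qed
        then have "a \<in> line_ideal s" using inj a(1,2) F_eval by auto
        from eval_line_ideal[OF this] have zero: "eval_mpoly f (line_point s t) = 0" if "t \<notin> T" for t
          using eq[of t] F_eval[of t] that by simp
        have "f \<in> line_ideal s"
        proof (rule ccontr)
          assume "f \<notin> line_ideal s"
          then have "finite ({t. eval_mpoly f (line_point s t) = 0} \<union> T)"
            using finite_zeros_on_line[OF f(1)] T(1) by auto
          moreover have "{t. eval_mpoly f (line_point s t) = 0} \<union> T = UNIV" using zero by blast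
          ultimately show False using inf by simp
        qed
        then show ?thesis using line_ideal_subset[OF Iid] by blast
      qed
      then show ?thesis unfolding max_rank_def by blast
    next
      assume surj: "\<forall>c. \<exists>v\<in>I \<inter> forms (n + d). \<forall>t\<in>T. eval_mpoly v (line_point s t) = c t"
      have "g \<in> adjoin ?J F" if g: "g \<in> forms (n + d)" for g
      proof -
        obtain v where v: "v \<in> I" "v \<in> forms (n + d)"
          "\<And>t. t \<in> T \<Longrightarrow> eval_mpoly v (line_point s t) = eval_mpoly g (line_point s t)"
          using surj[THEN spec, of "\<lambda>t. eval_mpoly g (line_point s t)"] by auto
        have "g - v \<in> adjoin (line_ideal s) F"
          using form_vanishing_at_points[OF T(1) forms_diff[OF g v(2)], of s] v(3) by (simp add: F_def)
        then have "g - v \<in> adjoin ?J F" using adjoin_mono[OF line_ideal_subset[OF Iid]] by blast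
        moreover have "v \<in> adjoin ?J F" using v(1) subset_adjoin by blast
        ultimately have "(g - v) + v \<in> adjoin ?J F" by (rule ideal_add[OF ideal_adjoin[OF Jid]])
        then show ?thesis by simp
      qed
      then show ?thesis unfolding max_rank_def by blast
    qed
  qed
  with F show ?thesis by blast
qed

text \<open>
  The cokernels of \<open>F\<close> on \<open>R/(I + (L))\<close> and of \<open>L\<close> on \<open>R/(I + (F))\<close> are both \<open>R/(I + (F, L))\<close>.
  For the kernels, let \<open>L * f = a + g * F\<close> with \<open>a \<in> I\<close>. Then \<open>F * g \<in> I + (L)\<close>, and if this forces
  \<open>g = b + h * L\<close> with \<open>b \<in> I\<close>, then \<open>L * (f - h * F) \<in> I\<close>, where \<open>L\<close> can be cancelled.
\<close>

lemma max_rank_exchange: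
  fixes I :: "('v, 'k::comm_ring_1) mpoly set"
  assumes I: "homogeneous_ideal I" and F: "F \<in> forms d" and L: "L \<in> forms e"
    and nzd: "\<And>f. L * f \<in> I \<Longrightarrow> f \<in> I"
    and rank: "\<And>n. max_rank (adjoin I L) d F n"
  shows "max_rank (adjoin I F) e L n"
proof -
  note Iid = homogeneous_idealD(1)[OF I]
  have key: "f \<in> adjoin I F" if f: "L * f = a + g * F" "a \<in> I" "g \<in> adjoin I L" for f a g
  proof -
    from f(3) obtain b h where g: "b \<in> I" "g = b + h * L" by (rule adjoinE)
    have "L * (f - h * F) = a + b * F" using f(1) g(2) by (simp add: algebra_simps)
    also have "\<dots> \<in> I" by (intro ideal_add[OF Iid] ideal_mult_right[OF Iid] f(2) g(1))
    finally have "f - h * F \<in> I" by (rule nzd)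
    then show ?thesis by (rule adjoinI[of _ _ _ h]) simp
  qed
  show ?thesis
  proof (cases "n + e < d")
    case True
    \<comment> \<open>there are no multiples of \<open>F\<close> in degree \<open>n + e\<close>, so \<open>L * f \<in> I\<close>\<close>
    have "f \<in> adjoin I F" if f: "f \<in> forms n" "L * f \<in> adjoin I F" for f
    proof -
      have "L * f \<in> forms (n + e)" using forms_mult[OF L f(1)] by (simp add: add.commute)
      with f(2) obtain a g where "a \<in> I" "a \<in> forms (n + e)" "g \<in> forms (n + e - d)"
          "L * f = a + g * F" "n + e < d \<longrightarrow> g = 0"
        by (rule form_in_adjoinE[OF I F])
      with True show ?thesis
        by (intro key[of f a 0] ideal_zero[OF ideal_adjoin[OF Iid]]) auto
    qed
    then show ?thesis unfolding max_rank_def by blast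
  next
    case False
    define j where "j = n + e - d"
    have j: "j + d = n + e" using False by (simp add: j_def)
    from rank[of j] show ?thesis unfolding max_rank_def j
    proof
      assume inj: "\<forall>f\<in>forms j. F * f \<in> adjoin I L \<longrightarrow> f \<in> adjoin I L"
      have "f \<in> adjoin I F" if f: "f \<in> forms n" "L * f \<in> adjoin I F" for f
      proof -
        have "L * f \<in> forms (n + e)" using forms_mult[OF L f(1)] by (simp add: add.commute)
        with f(2) obtain a g where a: "a \<in> I" "g \<in> forms (n + e - d)" "L * f = a + g * F"
          by (rule form_in_adjoinE[OF I F])
        have "F * g = - a + f * L" using a(3) by (simp add: algebra_simps)
        then have "F * g \<in> adjoin I L" by (rule adjoinI[rotated]) (rule ideal_minus[OF Iid a(1)])
        with inj a(2) have "g \<in> adjoin I L" by (simp add: j_def)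
        with a show ?thesis by (intro key)
      qed
      then show "(\<forall>f\<in>forms n. L * f \<in> adjoin I F \<longrightarrow> f \<in> adjoin I F) \<or> forms (n + e) \<subseteq> adjoin (adjoin I F) L"
        by blast
    next
      assume surj: "forms (n + e) \<subseteq> adjoin (adjoin I L) F"
      have "adjoin (adjoin I L) F \<subseteq> adjoin (adjoin I F) L"
        by (intro adjoin_subset ideal_adjoin Iid adjoin_mono subset_adjoin
            subsetD[OF subset_adjoin mem_adjoin[OF Iid]])
      with surj show "(\<forall>f\<in>forms n. L * f \<in> adjoin I F \<longrightarrow> f \<in> adjoin I F) \<or> forms (n + e) \<subseteq> adjoin (adjoin I F) L"
        by blast
    qed
  qed
qed

lemma forms_subset_adjoin_power:
  fixes I :: "('v, 'k::comm_ring_1) mpoly set"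
  assumes I: "ideal I poly_ring" and sub: "forms n \<subseteq> adjoin I L"
  shows "forms (n * d) \<subseteq> adjoin I (L ^ d)"
proof (induction d)
  case 0
  show ?case by (auto intro: adjoinI[of 0 _ _ f for f] ideal_zero[OF I])
next
  case (Suc d)
  have "forms (n + n * d) \<subseteq> adjoin I (L ^ Suc d)"
  proof (rule forms_add_subset_ideal[OF ideal_adjoin[OF I]])
    fix f g :: "('v, 'k) mpoly" assume "f \<in> forms n" "g \<in> forms (n * d)"
    then have "f \<in> adjoin I L" "g \<in> adjoin I (L ^ d)" using sub Suc.IH by auto
    then obtain a r b u where f: "a \<in> I" "f = a + r * L" and g: "b \<in> I" "g = b + u * L ^ d"
      by (auto elim!: adjoinE)
    show "f * g \<in> adjoin I (L ^ Suc d)"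
    proof (rule adjoinI)
      show "a * g + r * L * b \<in> I"
        by (intro ideal_add[OF I] ideal_mult[OF I g(1)] ideal_mult_right[OF I f(1)])
      show "f * g = (a * g + r * L * b) + (r * u) * L ^ Suc d"
        by (simp add: f(2) g(2) algebra_simps)
    qed
  qed
  then show ?case by simp
qed

section \<open>Artinian quotients and the weak Lefschetz property\<close>

lemma coset_eq_iff:
  fixes I :: "('v, 'k::comm_ring_1) mpoly set"
  assumes I: "ideal I poly_ring"
  shows "I +>\<^bsub>poly_ring\<^esub> f = I +>\<^bsub>poly_ring\<^esub> g \<longleftrightarrow> f - g \<in> I"
proof -
  have mem: "h \<in> I +>\<^bsub>poly_ring\<^esub> f \<longleftrightarrow> h - f \<in> I" for h f
    by (auto simp: a_r_coset_def' intro!: bexI[of _ "h - f"])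
  show ?thesis
  proof
    assume "I +>\<^bsub>poly_ring\<^esub> f = I +>\<^bsub>poly_ring\<^esub> g"
    moreover have "f \<in> I +>\<^bsub>poly_ring\<^esub> f" by (simp add: mem ideal_zero[OF I])
    ultimately show "f - g \<in> I" by (simp add: mem)
  next
    assume fg: "f - g \<in> I"
    have "h - f \<in> I \<longleftrightarrow> h - g \<in> I" for h
      using ideal_add[OF I _ fg, of "h - f"] ideal_diff[OF I _ fg, of "h - g"] by auto
    then show "I +>\<^bsub>poly_ring\<^esub> f = I +>\<^bsub>poly_ring\<^esub> g"
      by (simp add: mem set_eq_iff)
  qed
qed

lemma mult_by_coset:
  fixes I :: "('v, 'k::comm_ring_1) mpoly set"
  assumes "ideal I poly_ring"
  shows "mult_by I L (I +>\<^bsub>poly_ring\<^esub> f) = I +>\<^bsub>poly_ring\<^esub> (L * f)"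
  using ideal.rcoset_mult_add[OF assms, of L f] by (simp add: mult_by_def FactRing_def)

lemma inj_or_surj_if_max_rank:
  fixes I :: "('v, 'k::comm_ring_1) mpoly set"
  assumes I: "homogeneous_ideal I" and L: "L \<in> forms 1" and rank: "max_rank I 1 L n"
  shows "inj_on (mult_by I L) (graded_piece I n) \<or>
    mult_by I L ` graded_piece I n = graded_piece I (Suc n)"
proof -
  note Iid = homogeneous_idealD(1)[OF I]
  from rank show ?thesis unfolding max_rank_def
  proof
    assume inj: "\<forall>f\<in>forms n. L * f \<in> I \<longrightarrow> f \<in> I"
    have "inj_on (mult_by I L) (graded_piece I n)"
      using inj forms_diff[of _ n]
      by (auto simp: inj_on_def graded_piece_def mult_by_coset[OF Iid] coset_eq_iff[OF Iid]
          simp flip: right_diff_distrib)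
    then show ?thesis ..
  next
    assume surj: "forms (n + 1) \<subseteq> adjoin I L"
    have "mult_by I L ` graded_piece I n = graded_piece I (Suc n)"
    proof
      show "mult_by I L ` graded_piece I n \<subseteq> graded_piece I (Suc n)"
        using forms_mult[OF L, of _ n] by (auto simp: graded_piece_def mult_by_coset[OF Iid])
      show "graded_piece I (Suc n) \<subseteq> mult_by I L ` graded_piece I n"
      proof
        fix A assume "A \<in> graded_piece I (Suc n)"
        then obtain g where g: "g \<in> forms (Suc n)" "A = I +>\<^bsub>poly_ring\<^esub> g" by (auto simp: graded_piece_def)
        have "g \<in> adjoin I L" using surj g(1) by auto
        then obtain a r where r: "a \<in> I" "r \<in> forms (Suc n - 1)" "g = a + r * L"
          using g(1) by (rule form_in_adjoinE[OF I L])
        have "A = mult_by I L (I +>\<^bsub>poly_ring\<^esub> r)"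
          using r(1,3) by (simp add: g(2) mult_by_coset[OF Iid] coset_eq_iff[OF Iid] algebra_simps)
        with r(2) show "A \<in> mult_by I L ` graded_piece I n" by (auto simp: graded_piece_def)
      qed
    qed
    then show ?thesis ..
  qed
qed

text \<open>
  Ideals that contain all forms of degree \<open>M\<close> are determined by their traces on the
  finite-dimensional span of the monomials of degree less than \<open>M\<close>, and the dimensions of the
  traces cannot decrease forever.
\<close>

lemma ideals_stabilize_if_finite_colength:
  fixes U :: "nat \<Rightarrow> ('v::finite, 'k::field) mpoly set"
  assumes U: "\<And>n. ideal (U n) poly_ring" "\<And>n. U (Suc n) \<subseteq> U n" and M: "\<And>n. forms M \<subseteq> U n"
  shows "\<exists>n. \<forall>m\<ge>n. U m = U n"
proof -
  interpret vector_space "\<lambda>c (f :: ('v, 'k) mpoly). Const c * f"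
    by unfold_locales (simp_all add: single_add distrib_left distrib_right mult_single flip: mult.assoc)
  define A :: "('v, 'k) mpoly set" where "A = Mon ` (\<Union>d<M. monoms_of_deg d)"
  have A: "finite A" unfolding A_def using finite_monoms_of_deg by blast
  have dec: "U m \<subseteq> U n" if "n \<le> m" for m n
    using that U(2) by (rule lift_Suc_antimono_le[rotated])
  \<comment> \<open>every \<open>f\<close> has a representative of degree less than \<open>M\<close>, the same for all ideals of the chain\<close>
  have reduce: "\<exists>l\<in>span A. \<forall>n. f - l \<in> U n" for f
  proof (induction f rule: mpoly_induct)
    case zero
    show ?case by (rule bexI[of _ 0]) (auto simp: span_zero ideal_zero[OF U(1)])
  next
    case (add f g)
    then obtain l l' where l: "l \<in> span A" "l' \<in> span A" "\<forall>n. f - l \<in> U n" "\<forall>n. g - l' \<in> U n" by blast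
    have eq: "f + g - (l + l') = (f - l) + (g - l')" by simp
    have "f + g - (l + l') \<in> U n" for n
      unfolding eq using l(3,4) by (intro ideal_add[OF U(1)]) auto
    with l(1,2) show ?case using span_add by blast
  next
    case (single m c)
    show ?case
    proof (cases "monom_deg m < M")
      case True
      then have "Mon m \<in> A" by (auto simp: A_def monoms_of_deg_def)
      then have "Const c * Mon m \<in> span A" by (intro span_scale span_base)
      then show ?thesis
        by (intro bexI[of _ "Const c * Mon m"]) (simp_all add: mult_single ideal_zero[OF U(1)])
    next
      case False
      then have "forms (monom_deg m) \<subseteq> U n" for n
        by (intro forms_subset_ideal_mono[OF U(1) M]) simp
      then show ?thesis
        by (intro bexI[of _ 0]) (auto simp: span_zero intro: single_in_forms)
    qed
  qed
  have sub: "subspace (U n \<inter> span A)" for n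
    by (auto simp: subspace_def span_zero span_add span_scale ideal_zero[OF U(1)] ideal_add[OF U(1)]
        ideal_mult[OF U(1)])
  define n where "n = (ARG_MIN (\<lambda>n. dim (U n \<inter> span A)) n. True)"
  have min: "dim (U n \<inter> span A) \<le> dim (U m \<inter> span A)" for m
    unfolding n_def by (rule arg_min_nat_le) simp
  have "U n \<subseteq> U m" if "n \<le> m" for m
  proof
    fix f assume f: "f \<in> U n"
    obtain l where l: "l \<in> span A" "\<And>n. f - l \<in> U n" using reduce by blast
    have "f - (f - l) \<in> U n" by (intro ideal_diff[OF U(1)] f l)
    then have l_n: "l \<in> U n \<inter> span A" using l(1) by simp
    have "l \<in> U m"
    proof (rule ccontr)
      assume n: "l \<notin> U m"
      obtain B where B: "B \<subseteq> U m \<inter> span A" "independent B" "U m \<inter> span A \<subseteq> span B"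
        "card B = dim (U m \<inter> span A)" by (rule basis_exists)
      obtain C where C: "C \<subseteq> U n \<inter> span A" "independent C" "U n \<inter> span A \<subseteq> span C"
        "card C = dim (U n \<inter> span A)" by (rule basis_exists)
      have "span B \<subseteq> U m \<inter> span A" using span_minimal[OF B(1) sub] .
      with n have "l \<notin> span B" "l \<notin> B" using span_base by auto
      then have "independent (insert l B)" by (intro independent_insertI B(2))
      moreover have "insert l B \<subseteq> span C" using B(1) C(3) l_n dec[OF \<open>n \<le> m\<close>] by blast
      moreover have "finite C" using independent_span_bound[OF A C(2)] C(1) by blast
      ultimately have "card (insert l B) \<le> card C" using independent_span_bound by blast
      moreover have "finite B" using independent_span_bound[OF A B(2)] B(1) by blast
      ultimately have "dim (U m \<inter> span A) < dim (U n \<inter> span A)"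
        using \<open>l \<notin> B\<close> B(4) C(4) by simp
      with min[of m] show False by simp
    qed
    then have "(f - l) + l \<in> U m" by (intro ideal_add[OF U(1)] l)
    then show "f \<in> U m" by simp
  qed
  with dec show ?thesis by blast
qed

lemma artinian_if_finite_colength:
  fixes I :: "('v::finite, 'k::field) mpoly set"
  assumes I: "ideal I poly_ring" and M: "forms M \<subseteq> I"
  shows "artinian_ring (poly_ring Quot I)"
  unfolding artinian_ring_def
proof (intro conjI allI impI)
  interpret I: ideal I poly_ring by fact
  show "cring (poly_ring Quot I)" by (rule I.quotient_is_cring[OF cring_poly_ring])
  fix J :: "nat \<Rightarrow> ('v, 'k) mpoly set set"
  assume J: "\<forall>n. ideal (J n) (poly_ring Quot I) \<and> J (Suc n) \<subseteq> J n"
  interpret hom: ring_hom_ring poly_ring "poly_ring Quot I" "(+>\<^bsub>poly_ring\<^esub>) I"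
    by (rule I.rcos_ring_hom_ring)
  define U where "U n = {f. I +>\<^bsub>poly_ring\<^esub> f \<in> J n}" for n
  have "ideal (U n) poly_ring" for n
    using hom.ideal_vimage[of "J n"] J by (simp add: U_def)
  moreover have "U (Suc n) \<subseteq> U n" for n using J by (auto simp: U_def)
  moreover have "forms M \<subseteq> U n" for n
  proof
    fix f :: "('v, 'k) mpoly" assume "f \<in> forms M"
    with M have "f \<in> I" by blast
    then have "I +>\<^bsub>poly_ring\<^esub> f = I +>\<^bsub>poly_ring\<^esub> 0" by (simp add: coset_eq_iff[OF I])
    also have "0 \<in> U n" by (rule ideal_zero) fact
    then have "I +>\<^bsub>poly_ring\<^esub> 0 \<in> J n" by (simp add: U_def)
    finally show "f \<in> U n" by (simp add: U_def)
  qed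
  ultimately have "\<exists>n. \<forall>m\<ge>n. U m = U n" by (rule ideals_stabilize_if_finite_colength)
  moreover have "J n = (\<lambda>f. I +>\<^bsub>poly_ring\<^esub> f) ` U n" for n
  proof -
    have "J n \<subseteq> carrier (poly_ring Quot I)"
      using J ideal.Icarr[of "J n" "poly_ring Quot I"] by blast
    then show ?thesis by (auto simp: U_def FactRing_def A_RCOSETS_def')
  qed
  ultimately show "\<exists>n. \<forall>m\<ge>n. J m = J n" by metis
qed

lemma for_general_form_mono:
  "for_general_form d P \<Longrightarrow> (\<And>F. P F \<Longrightarrow> Q F) \<Longrightarrow> for_general_form d Q"
  unfolding for_general_form_def by blast

lemma weak_lefschetz_if_max_rank:
  fixes I :: "('v::finite, 'k::field) mpoly set"
  assumes I: "homogeneous_ideal I" "forms M \<subseteq> I" and L: "L \<in> forms 1" "\<And>n. max_rank I 1 L n"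
  shows "weak_lefschetz I"
  unfolding weak_lefschetz_def
proof (intro conjI I(1) artinian_if_finite_colength[OF homogeneous_idealD(1)[OF I(1)] I(2)])
  have "zariski_near 1 L (\<lambda>L. \<forall>n. max_rank I 1 L n)"
    by (rule zariski_near_max_rank[OF I L])
  then show "for_general_form 1 (\<lambda>L. \<forall>i. inj_on (mult_by I L) (graded_piece I i) \<or>
      mult_by I L ` graded_piece I i = graded_piece I (Suc i))"
    by (intro for_general_form_if_near[OF L(1)], elim zariski_near_mono)
       (use inj_or_surj_if_max_rank[OF I(1)] in blast)
qed

theorem proposition6p1:
  fixes I_X :: "(3, 'k::field) mpoly set" and d :: nat
  assumes "infinite (UNIV :: 'k set)"
    and "zeroscheme_ideal I_X"
  shows "for_general_form d (\<lambda>F.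
    artinian_ring (poly_ring Quot (I_X <+>\<^bsub>poly_ring\<^esub> PIdl\<^bsub>poly_ring\<^esub> F)) \<and>
    weak_lefschetz (I_X <+>\<^bsub>poly_ring\<^esub> PIdl\<^bsub>poly_ring\<^esub> F))"
proof -
  from assms(2) have I: "homogeneous_ideal I_X" "saturation I_X = I_X" "proj_dim I_X = 0"
    by (auto simp: zeroscheme_ideal_def)
  note Iid = homogeneous_idealD(1)[OF I(1)]
  obtain s N where N: "forms N \<subseteq> adjoin I_X (moment_form s)"
    using ex_moment_form_finite_colength[OF assms(1) I(1,3)] by blast
  define L where "L = moment_form s"
  have L: "L \<in> forms 1" unfolding L_def by (rule moment_form_in_forms)
  note N = N[folded L_def]
  obtain F1 where F1: "F1 \<in> forms d" "\<And>n. max_rank (adjoin I_X L) d F1 n"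
    using ex_form_max_rank[OF assms(1) I(1) N[unfolded L_def], of d] by (auto simp: L_def)
  have "zariski_near d F1 (\<lambda>F. \<forall>n. max_rank (adjoin I_X L) d F n)"
    by (rule zariski_near_max_rank[OF homogeneous_ideal_adjoin[OF I(1) L] N F1])
  then have near1: "zariski_near d F1 (\<lambda>F. F \<in> forms d \<and> (\<forall>n. max_rank (adjoin I_X L) d F n))"
    by (rule zariski_near_mono) simp
  have F2: "L ^ d \<in> forms d" using forms_power[OF L, of d] by simp
  have near2: "zariski_near d (L ^ d) (\<lambda>F. forms (N * d) \<subseteq> adjoin I_X F)"
    by (rule zariski_near_forms_subset_adjoin[OF I(1) F2 forms_subset_adjoin_power[OF Iid N]])
  show ?thesis
    unfolding set_add_PIdl_eq_adjoin
  proof (rule for_general_form_mono[OF for_general_form_if_near_two[OF assms(1) F1(1) F2 near1 near2]])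
    fix F
    assume F: "(F \<in> forms d \<and> (\<forall>n. max_rank (adjoin I_X L) d F n)) \<and> forms (N * d) \<subseteq> adjoin I_X F"
    have "max_rank (adjoin I_X F) 1 L n" for n
    proof (rule max_rank_exchange[OF I(1) _ L])
      show "f \<in> I_X" if "L * f \<in> I_X" for f
        using nonzerodivisor_if_finite_colength[OF Iid I(2) N that] .
    qed (use F in auto)
    then have "weak_lefschetz (adjoin I_X F)"
      by (rule weak_lefschetz_if_max_rank[OF homogeneous_ideal_adjoin[OF I(1)] _ L, rotated 2]) (use F in auto)
    then show "artinian_ring (poly_ring Quot adjoin I_X F) \<and> weak_lefschetz (adjoin I_X F)"
      by (simp add: weak_lefschetz_def)
  qed
qed

end
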